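(* Let $E\sim\mathsf{Exp}(1)$ be an exponential random variable with mean $1$. Then \[\biggl(\frac{r!\,U_r^{(n)}}{\ln^r n},\ r\in\mathbb N\biggr)\xrightarrow{d}(E,E,\ldots)\quad\text{in }\mathbb R^{\infty}\text{ as }n\to\infty,\] where all the entries of the limiting random sequence are the same random variable $E$.
   Context: Extended coupon collector's problem. For each $n\in\mathbb N$, coupons arrive one by one at times $1,2,3,\ldots$; the types of the coupons are independent and uniformly distributed on $\{1,\ldots,n\}$. For $i\in\{1,\ldots,n\}$ and $r\in\mathbb N_0=\mathbb N\cup\{0\}$, let $Y_{i,r}^{(n)}$ be the arrival time of the $(r+1)$-th coupon of type $i$ (this is when the collector labelled $r$ receives a coupon of type $i$: each collector passes duplicates on to the next one, the main collector being labelled $0$). For $r\in\mathbb N$, let \[U_r^{(n)}=\operatorname{card}\bigl\{i\in\{1,\ldots,n\}\colon Y_{i,r}^{(n)}>\max_{1\le j\le n}Y_{j,0}^{(n)}\bigr\},\] the number of empty spots in the album of the $r$-th collector at the time $T_0^{(n)}=\max_{j\le n}Y_{j,0}^{(n)}$ when collector $0$ completes his collection. Here $\ln^r n=(\ln n)^r$, $\xrightarrow{d}$ denotes convergence in distribution, and $\mathbb R^\infty$ is the space of real sequences with the product topology. *)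

theory Defs
  imports "HOL-Probability.Probability"
begin

text \<open>
  A sample path of coupons is a function \<open>c\<close>, where \<open>c t\<close> is the type of the coupon arriving at
  time \<open>t = 1, 2, \<dots>\<close>; the value \<open>c 0\<close> is never used.
\<close>

text \<open>
  The arrival time $Y_{i,r}$ of the $(r+1)$-th coupon of type \<open>i\<close>: the set below has at
  most one element, and the value is \<open>\<infinity>\<close> (the infimum of the empty set) if fewer than $r+1$
  coupons of type \<open>i\<close> ever arrive.
\<close>

definition arrival_time :: "(nat \<Rightarrow> nat) \<Rightarrow> nat \<Rightarrow> nat \<Rightarrow> enat" where
  "arrival_time c i r =
     Inf {enat t | t. 1 \<le> t \<and> c t = i \<and> card {s. 1 \<le> s \<and> s < t \<and> c s = i} = r}"

definition completion_time :: "nat \<Rightarrow> (nat \<Rightarrow> nat) \<Rightarrow> enat" where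
  "completion_time n c = Max ((\<lambda>j. arrival_time c j 0) ` {1..n})"

definition empty_spots :: "nat \<Rightarrow> (nat \<Rightarrow> nat) \<Rightarrow> nat \<Rightarrow> nat" where
  "empty_spots n c r = card {i \<in> {1..n}. arrival_time c i r > completion_time n c}"

text \<open>
  Convergence in distribution of random elements \<open>X n\<close>, each on its own probability space \<open>M n\<close>,
  to a random element \<open>Y\<close> on \<open>N\<close>. Only the tail of the sequence matters. For sequence-valued
  random elements (type \<open>nat \<Rightarrow> real\<close>) the topology of the type class is the product topology.
\<close>

definition conv_in_distribution ::
  "(nat \<Rightarrow> 'a measure) \<Rightarrow> (nat \<Rightarrow> 'a \<Rightarrow> 'c::topological_space) \<Rightarrow> 'b measure \<Rightarrow> ('b \<Rightarrow> 'c) \<Rightarrow> bool" where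
  "conv_in_distribution M X N Y \<longleftrightarrow>
     (\<forall>\<^sub>F n in sequentially. X n \<in> borel_measurable (M n)) \<and>
     Y \<in> borel_measurable N \<and>
     (\<forall>f :: 'c \<Rightarrow> real. continuous_on UNIV f \<and> bounded (range f) \<longrightarrow>
        (\<lambda>n. \<integral>\<omega>. f (X n \<omega>) \<partial>M n) \<longlonglongrightarrow> (\<integral>\<omega>. f (Y \<omega>) \<partial>N))"

end

theory Submission
  imports Defs "HOL-Real_Asymp.Real_Asymp"
begin

text \<open>
  Write \<open>W\<^sub>r(t)\<close> for the number of types of which at most \<open>r\<close> coupons have arrived by time \<open>t\<close>
  (the constant \<open>missing\<close> below), and \<open>T\<close> for the time at which collector \<open>0\<close> finishes. Then
  \<open>U\<^sub>r = W\<^sub>r(T)\<close>, and \<open>T \<le> t\<close> holds exactly when \<open>W\<^sub>0(t) = 0\<close>. The whole limit theorem comes from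
  looking at the functions \<open>W\<^sub>r\<close> at times \<open>t = n ln (n / z) + O(1)\<close> with \<open>z > 0\<close> fixed, where three
  things happen.

  \<^item> The expected number \<open>n (1 - 1 / n)\<^sup>t\<close> of types not yet seen tends to \<open>z\<close>, and \<open>W\<^sub>0(t)\<close> is
    asymptotically Poisson. In particular \<open>P(W\<^sub>0(t) = 0) \<longlonglongrightarrow> exp (- z)\<close>, by
    inclusion-exclusion and Tannery's theorem (\<open>complete_prob_limit\<close>). In terms of the rescaled
    completion time \<open>Z = n exp (- T / n)\<close> it says \<open>P(Z \<ge> z) \<longlonglongrightarrow> exp (- z)\<close>, so \<open>Z\<close> converges in
    distribution to \<open>E\<close>. This is the Gumbel limit law of the coupon collector, written
    multiplicatively.

  \<^item> For \<open>r \<ge> 1\<close> the mean of \<open>W\<^sub>r(t)\<close> is asymptotic to \<open>z (ln n)\<^sup>r / r!\<close>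
    (\<open>few_copies_limit\<close>), which tends to infinity.

  \<^item> The indicators summed in \<open>W\<^sub>r(t)\<close> are almost uncorrelated (\<open>prob_two_few_copies_le\<close>), so for
    \<open>r \<ge> 1\<close> the second moment method gives \<open>r! W\<^sub>r(t) / (ln n)\<^sup>r \<longlonglongrightarrow> z\<close> in probability
    (\<open>missing_concentration\<close>).

  The random time \<open>T\<close> corresponds to the random value \<open>z = Z\<close>. Since \<open>W\<^sub>r\<close> is decreasing in \<open>t\<close>,
  convergence in probability at finitely many values of \<open>z\<close> forces \<open>r! W\<^sub>r(T) / (ln n)\<^sup>r\<close> to be close
  to \<open>Z\<close> (\<open>empty_spots_near_rescaled_completion\<close>). Hence \<open>r! U\<^sub>r / (ln n)\<^sup>r - Z\<close> tends to \<open>0\<close> in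
  probability for every \<open>r \<ge> 1\<close>, with the same \<open>Z\<close> for all \<open>r\<close>, and a Slutsky argument in the
  product topology (\<open>conv_in_distribution_constant_sequence\<close>) turns this into the joint convergence
  to the constant sequence \<open>(E, E, \<dots>)\<close>.
\<close>

section \<open>Sample paths\<close>

definition copies :: "(nat \<Rightarrow> nat) \<Rightarrow> nat \<Rightarrow> nat \<Rightarrow> nat" where
  "copies c i t = card {s \<in> {1..t}. c s = i}"

definition missing :: "nat \<Rightarrow> (nat \<Rightarrow> nat) \<Rightarrow> nat \<Rightarrow> nat \<Rightarrow> nat" where
  "missing n c r t = card {i \<in> {1..n}. copies c i t \<le> r}"

lemma copies_0 [simp]: "copies c i 0 = 0"
  by (simp add: copies_def)

lemma copies_Suc: "copies c i (Suc t) = copies c i t + (if c (Suc t) = i then 1 else 0)"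
proof -
  have "{s \<in> {1..Suc t}. c s = i} =
        (if c (Suc t) = i then insert (Suc t) {s \<in> {1..t}. c s = i} else {s \<in> {1..t}. c s = i})"
    by (auto simp: le_Suc_eq)
  then show ?thesis
    by (auto simp: copies_def)
qed

lemma copies_mono: "t \<le> t' \<Longrightarrow> copies c i t \<le> copies c i t'"
  unfolding copies_def by (intro card_mono) auto

lemma missing_antimono: "t \<le> t' \<Longrightarrow> missing n c r t' \<le> missing n c r t"
  unfolding missing_def using copies_mono[of t t' c] by (intro card_mono) (auto intro: le_trans)

lemma missing_le: "missing n c r t \<le> n"
proof -
  have "card {i \<in> {1..n}. copies c i t \<le> r} \<le> card {1..n}"
    by (intro card_mono) auto
  then show ?thesis by (simp add: missing_def)
qed

text \<open>
  The counts \<open>copies c i t\<close> climb in unit steps, so the coupon of type \<open>i\<close> that arrives when exactly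
  \<open>r\<close> earlier ones are present is the one at which the count first exceeds \<open>r\<close>.
\<close>

lemma arrival_time_le_iff: "arrival_time c i r \<le> enat t \<longleftrightarrow> r < copies c i t"
proof -
  define S where "S = {t. 1 \<le> t \<and> c t = i \<and> card {s. 1 \<le> s \<and> s < t \<and> c s = i} = r}"
  have S_iff: "Suc s \<in> S \<longleftrightarrow> c (Suc s) = i \<and> copies c i s = r" for s
  proof -
    have "{s'. 1 \<le> s' \<and> s' < Suc s \<and> c s' = i} = {s' \<in> {1..s}. c s' = i}"
      by auto
    then show ?thesis by (simp add: S_def copies_def)
  qed
  have "0 \<notin> S" by (simp add: S_def)
  have arr: "arrival_time c i r = Inf (enat ` S)"
    unfolding arrival_time_def S_def by (intro arg_cong[where f = Inf]) auto
  have "(\<exists>s\<in>S. s \<le> t) \<longleftrightarrow> r < copies c i t"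
  proof
    assume "\<exists>s\<in>S. s \<le> t"
    then obtain s where s: "Suc s \<in> S" "Suc s \<le> t"
      using \<open>0 \<notin> S\<close> by (metis not0_implies_Suc)
    have "copies c i (Suc s) = Suc r"
      using s(1) by (simp add: S_iff copies_Suc)
    with copies_mono[OF s(2), of c i] show "r < copies c i t" by simp
  next
    assume "r < copies c i t"
    then show "\<exists>s\<in>S. s \<le> t"
    proof (induction t)
      case (Suc t)
      show ?case
      proof (cases "r < copies c i t")
        case True
        then show ?thesis using Suc.IH by (meson le_Suc_eq)
      next
        case False
        then have "Suc t \<in> S"
          using Suc.prems by (auto simp: S_iff copies_Suc split: if_splits)
        then show ?thesis by blast
      qed
    qed simp
  qed
  moreover have "Inf (enat ` S) \<le> enat t \<longleftrightarrow> (\<exists>s\<in>S. s \<le> t)"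
  proof
    assume le: "Inf (enat ` S) \<le> enat t"
    then have "enat ` S \<noteq> {}" by (auto simp: Inf_enat_def)
    then have "Inf (enat ` S) \<in> enat ` S" 
      unfolding Inf_enat_def by (auto intro: LeastI)
    then show "\<exists>s\<in>S. s \<le> t" using le by auto
  next
    assume "\<exists>s\<in>S. s \<le> t"
    then show "Inf (enat ` S) \<le> enat t"
      by (meson Inf_lower enat_ord_simps(1) image_eqI order_trans)
  qed
  ultimately show ?thesis by (simp add: arr)
qed

lemma completion_time_le_iff:
  assumes "n \<ge> 1"
  shows "completion_time n c \<le> enat t \<longleftrightarrow> missing n c 0 t = 0"
proof -
  have "completion_time n c \<le> enat t \<longleftrightarrow> (\<forall>i\<in>{1..n}. 0 < copies c i t)"
    unfolding completion_time_def using assms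
    by (subst Max_le_iff) (auto simp: arrival_time_le_iff)
  also have "\<dots> \<longleftrightarrow> missing n c 0 t = 0"
    by (auto simp: missing_def)
  finally show ?thesis .
qed

text \<open>
  This form makes the completion time visibly measurable: it is a least element of a set of natural
  numbers whose membership is decided by finitely many coupons.
\<close>

lemma completion_time_eq:
  assumes "n \<ge> 1"
  shows "completion_time n c = (if \<exists>t. missing n c 0 t = 0 then enat (LEAST t. missing n c 0 t = 0) else \<infinity>)"
proof (cases "completion_time n c")
  case (enat t)
  then have "missing n c 0 t' = 0 \<longleftrightarrow> t \<le> t'" for t'
    using completion_time_le_iff[OF assms, of c t'] by simp
  then have "(LEAST t'. missing n c 0 t' = 0) = t" and "\<exists>t'. missing n c 0 t' = 0"
    by (auto intro: Least_equality)
  then show ?thesis by (simp add: enat)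
next
  case infinity
  then show ?thesis
    using completion_time_le_iff[OF assms, of c] by simp
qed

lemma empty_spots_at_completion:
  assumes "completion_time n c = enat t"
  shows "empty_spots n c r = missing n c r t"
  using arrival_time_le_iff[of c _ r t]
  by (simp add: empty_spots_def missing_def assms flip: not_le)

lemma empty_spots_never_completed:
  assumes "completion_time n c = \<infinity>"
  shows "empty_spots n c r = 0"
  by (simp add: empty_spots_def assms)

text \<open>
  For finite \<open>T\<close> this is \<open>exp (- (T - n ln n) / n)\<close>, a decreasing function of the completion time \<open>T\<close> that is
  exponentially distributed in the limit. The value \<open>0\<close> at \<open>T = \<infinity>\<close> is the limit as \<open>T\<close> grows; it
  makes the statements below hold on every sample path, so that paths on which some type never
  arrives need no separate treatment.
\<close>

definition rescaled_completion :: "nat \<Rightarrow> (nat \<Rightarrow> nat) \<Rightarrow> real" where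
  "rescaled_completion n c =
     (case completion_time n c of enat t \<Rightarrow> real n * exp (- real t / real n) | \<infinity> \<Rightarrow> 0)"

lemma rescaled_completion_nonneg: "0 \<le> rescaled_completion n c"
  by (simp add: rescaled_completion_def split: enat.split)

lemma exp_time_ge_iff:
  assumes "n \<ge> 1" "z > 0"
  shows "z \<le> real n * exp (- real t / real n) \<longleftrightarrow> real t \<le> real n * ln (real n / z)"
proof -
  have "z \<le> real n * exp (- real t / real n) \<longleftrightarrow> exp (real t / real n) \<le> real n / z"
    using assms by (simp add: exp_minus field_simps)
  also have "\<dots> \<longleftrightarrow> real t / real n \<le> ln (real n / z)"
    using assms by (subst ln_ge_iff) auto
  also have "\<dots> \<longleftrightarrow> real t \<le> real n * ln (real n / z)"
    using assms by (simp add: field_simps)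
  finally show ?thesis .
qed

text \<open>
  The last time \<open>t\<close> at which \<open>n exp (- t / n)\<close>, which is close to the expected number of types not
  yet seen, is still at least \<open>z\<close>. This reading requires \<open>0 < z \<le> n\<close>; for \<open>z > n\<close> there is no such
  time and the value is \<open>0\<close>.
\<close>

definition stage :: "real \<Rightarrow> nat \<Rightarrow> nat" where
  "stage z n = nat \<lfloor>real n * ln (real n / z)\<rfloor>"

lemma le_stage_iff:
  assumes "n \<ge> 1" "0 < z" "z \<le> real n"
  shows "t \<le> stage z n \<longleftrightarrow> z \<le> real n * exp (- real t / real n)"
proof -
  have "0 \<le> real n * ln (real n / z)"
    using assms by simp
  then have "t \<le> stage z n \<longleftrightarrow> real t \<le> real n * ln (real n / z)"
    unfolding stage_def by (simp add: le_nat_iff le_floor_iff)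
  then show ?thesis
    using exp_time_ge_iff[OF assms(1,2)] by simp
qed

lemma rescaled_completion_ge_iff:
  assumes "n \<ge> 1" "0 < z" "z \<le> real n"
  shows "z \<le> rescaled_completion n c \<longleftrightarrow> missing n c 0 (stage z n) = 0"
proof -
  have "z \<le> rescaled_completion n c \<longleftrightarrow> completion_time n c \<le> enat (stage z n)"
    using assms le_stage_iff[OF assms]
    by (auto simp: rescaled_completion_def split: enat.split)
  then show ?thesis using completion_time_le_iff[OF assms(1)] by simp
qed

section \<open>The first two moments of the number of rare types\<close>

lemma sum_over_subsets_by_card:
  fixes g :: "nat \<Rightarrow> real"
  assumes "finite A" "finite K"
  shows "(\<Sum>X | X \<subseteq> A \<and> card X \<in> K. g (card X)) = (\<Sum>k\<in>K. real (card A choose k) * g k)"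
proof -
  have "(\<Sum>X | X \<subseteq> A \<and> card X \<in> K. g (card X)) =
        (\<Sum>k\<in>K. \<Sum>X | X \<in> {X. X \<subseteq> A \<and> card X \<in> K} \<and> card X = k. g (card X))"
    using assms by (intro sum.group[symmetric]) auto
  also have "\<dots> = (\<Sum>k\<in>K. \<Sum>X | X \<subseteq> A \<and> card X = k. g k)"
    by (intro sum.cong) auto
  also have "\<dots> = (\<Sum>k\<in>K. real (card A choose k) * g k)"
    by (simp add: n_subsets assms)
  finally show ?thesis .
qed

lemma prod_if_mem_subset:
  fixes x y :: real
  assumes "A \<subseteq> {1..t}"
  shows "(\<Prod>s\<in>{1..t}. if s \<in> A then x else y) = x ^ card A * y ^ (t - card A)"
proof -
  have "{1..t} \<inter> A = A" "card ({1..t} \<inter> - A) = t - card A"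
    using assms by (auto simp: card_Diff_subset finite_subset simp flip: Diff_eq)
  then show ?thesis by (simp add: prod.If_cases)
qed

text \<open>
  The probability that a binomial variable with parameters \<open>t\<close> and \<open>1 / n\<close> is at most \<open>r\<close>.
\<close>

definition few_copies_prob :: "nat \<Rightarrow> nat \<Rightarrow> nat \<Rightarrow> real" where
  "few_copies_prob n r t = (\<Sum>a\<le>r. real (t choose a) * ((1 / n) ^ a * (1 - 1 / n) ^ (t - a)))"

locale uniform_coupons = prob_space M for M :: "'a measure" +
  fixes n :: nat and C :: "nat \<Rightarrow> 'a \<Rightarrow> nat"
  assumes n_pos: "n \<ge> 1"
    and indep: "indep_vars (\<lambda>_. count_space UNIV) C {1..}"
    and uniform: "\<And>t. t \<ge> 1 \<Longrightarrow> distr M (count_space UNIV) (C t) = measure_pmf (pmf_of_set {1..n})"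
begin

lemma coupon_measurable [measurable]: "t \<ge> 1 \<Longrightarrow> C t \<in> measurable M (count_space UNIV)"
  using indep by (auto simp: indep_vars_def)

lemma prob_coupon_in:
  assumes "t \<ge> 1"
  shows "prob (C t -` A \<inter> space M) = card ({1..n} \<inter> A) / n"
proof -
  have "prob (C t -` A \<inter> space M) = measure (distr M (count_space UNIV) (C t)) A"
    using assms by (subst measure_distr) auto
  also have "\<dots> = card ({1..n} \<inter> A) / n"
    using n_pos unfolding uniform[OF assms] by (subst measure_pmf_of_set) auto
  finally show ?thesis .
qed

lemma prob_coupons_in:
  "prob {\<omega> \<in> space M. \<forall>s\<in>{1..t}. C s \<omega> \<in> A s} = (\<Prod>s\<in>{1..t}. card ({1..n} \<inter> A s) / n)"
proof (cases "t = 0")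
  case True
  then show ?thesis by (simp add: prob_space)
next
  case False
  then have "{\<omega> \<in> space M. \<forall>s\<in>{1..t}. C s \<omega> \<in> A s} = (\<Inter>s\<in>{1..t}. C s -` A s \<inter> space M)"
    by fastforce
  also have "prob \<dots> = (\<Prod>s\<in>{1..t}. prob (C s -` A s \<inter> space M))"
    using False by (intro indep_varsD[OF indep]) auto
  also have "\<dots> = (\<Prod>s\<in>{1..t}. card ({1..n} \<inter> A s) / n)"
    by (intro prod.cong) (auto simp: prob_coupon_in)
  finally show ?thesis .
qed

lemma copies_measurable [measurable]: "(\<lambda>\<omega>. copies (\<lambda>s. C s \<omega>) i t) \<in> measurable M (count_space UNIV)"
proof (induction t)
  case (Suc t)
  have [measurable]: "C (Suc t) \<in> measurable M (count_space UNIV)" by (rule coupon_measurable) simp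
  note Suc [measurable]
  show ?case unfolding copies_Suc by measurable
qed simp

lemma missing_measurable [measurable]:
  "(\<lambda>\<omega>. missing n (\<lambda>s. C s \<omega>) r t) \<in> measurable M (count_space UNIV)"
proof -
  have "missing n c r t = (\<Sum>i\<in>{1..n}. if copies c i t \<le> r then 1 else 0)" for c
    by (simp add: missing_def sum.If_cases Int_def conj_commute)
  then show ?thesis by simp
qed

lemma completion_time_measurable [measurable]:
  "(\<lambda>\<omega>. completion_time n (\<lambda>s. C s \<omega>)) \<in> measurable M (count_space UNIV)"
  unfolding completion_time_eq[OF n_pos] by measurable

lemma rescaled_completion_measurable [measurable]:
  "(\<lambda>\<omega>. rescaled_completion n (\<lambda>s. C s \<omega>)) \<in> borel_measurable M"
  unfolding rescaled_completion_def by measurable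

lemma empty_spots_measurable [measurable]:
  "(\<lambda>\<omega>. empty_spots n (\<lambda>s. C s \<omega>) r) \<in> measurable M (count_space UNIV)"
proof -
  have "empty_spots n c r = (case completion_time n c of enat t \<Rightarrow> missing n c r t | \<infinity> \<Rightarrow> 0)" for c
    by (auto simp: empty_spots_at_completion empty_spots_never_completed split: enat.split)
  then show ?thesis by simp
qed

lemma integrable_indicator_event:
  "A \<in> events \<Longrightarrow> integrable M (indicator A :: 'a \<Rightarrow> real)"
  by (rule integrable_real_indicator) (auto simp: emeasure_eq_measure)

lemma prob_avoid:
  assumes "S \<subseteq> {1..n}"
  shows "prob {\<omega> \<in> space M. \<forall>s\<in>{1..t}. C s \<omega> \<notin> S} = (1 - card S / n) ^ t"
proof -
  have "finite S" using assms finite_subset by blast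
  have "card ({1..n} \<inter> - S) = n - card S"
    using assms \<open>finite S\<close> by (simp add: card_Diff_subset flip: Diff_eq)
  moreover have "card S \<le> n" using card_mono[OF _ assms] by simp
  ultimately have "card ({1..n} \<inter> - S) / n = 1 - card S / n"
    using n_pos by (simp add: of_nat_diff field_simps)
  then show ?thesis
    using prob_coupons_in[of t "\<lambda>_. - S"] by simp
qed

text \<open>
  Inclusion-exclusion over the set \<open>X\<close> of types that have not been seen: the event that all types
  have been seen has indicator \<open>\<Prod>i. (1 - u\<^sub>i)\<close>, where \<open>u\<^sub>i\<close> indicates that type \<open>i\<close> is unseen, and
  expanding the product leaves only the events that all types in \<open>X\<close> are avoided.
\<close>

lemma prob_complete:
  "prob {\<omega> \<in> space M. missing n (\<lambda>s. C s \<omega>) 0 t = 0} =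
     (\<Sum>j\<le>n. (-1) ^ j * real (n choose j) * (1 - j / n) ^ t)"
proof -
  define c where "c = (\<lambda>\<omega> s. C s \<omega>)"
  define u :: "nat \<Rightarrow> 'a \<Rightarrow> real" where "u i \<omega> = (if copies (c \<omega>) i t \<le> 0 then 1 else 0)" for i \<omega>
  have [measurable]: "u i \<in> borel_measurable M" for i
    unfolding u_def c_def by measurable
  have ind: "indicator {\<omega> \<in> space M. missing n (c \<omega>) 0 t = 0} \<omega> =
      (\<Sum>X\<in>Pow {1..n}. (-1) ^ card X * (\<Prod>i\<in>X. u i \<omega>))" if "\<omega> \<in> space M" for \<omega>
  proof -
    have "indicator {\<omega> \<in> space M. missing n (c \<omega>) 0 t = 0} \<omega> = (\<Prod>i\<in>{1..n}. 1 - u i \<omega>)"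
    proof (cases "missing n (c \<omega>) 0 t = 0")
      case True
      then have "u i \<omega> = 0" if "i \<in> {1..n}" for i
        using that by (auto simp: missing_def u_def)
      then have "(\<Prod>i\<in>{1..n}. 1 - u i \<omega>) = 1"
        by (intro prod.neutral) auto
      then show ?thesis using True that by simp
    next
      case False
      then obtain i where "i \<in> {1..n}" "copies (c \<omega>) i t \<le> 0"
        by (auto simp: missing_def)
      then have "(\<Prod>i\<in>{1..n}. 1 - u i \<omega>) = 0"
        by (intro prod_zero) (auto simp: u_def)
      then show ?thesis using False by simp
    qed
    also have "\<dots> = (\<Sum>X\<in>Pow {1..n}. (-1) ^ card X * (\<Prod>i\<in>X. u i \<omega>))"
      by (subst prod_diff_conv_sum) auto
    finally show ?thesis .
  qed
  have prod_u: "(\<Prod>i\<in>X. u i \<omega>) = indicator {\<omega> \<in> space M. \<forall>s\<in>{1..t}. C s \<omega> \<notin> X} \<omega>"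
    if "\<omega> \<in> space M" "finite X" for X \<omega>
  proof (cases "\<forall>s\<in>{1..t}. C s \<omega> \<notin> X")
    case True
    then have "copies (c \<omega>) i t = 0" if "i \<in> X" for i
      using that by (auto simp: copies_def c_def)
    then show ?thesis using True that by (auto simp: u_def)
  next
    case False
    then obtain s where s: "s \<in> {1..t}" "C s \<omega> \<in> X" by auto
    then have "copies (c \<omega>) (C s \<omega>) t > 0"
      by (auto simp: copies_def c_def card_gt_0_iff)
    then have "u (C s \<omega>) \<omega> = 0" by (simp add: u_def)
    then have "(\<Prod>i\<in>X. u i \<omega>) = 0" using s that by (auto intro!: prod_zero)
    then show ?thesis using False by simp
  qed
  have [measurable]: "{\<omega> \<in> space M. \<forall>s\<in>{1..t}. C s \<omega> \<notin> X} \<in> sets M" for X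
  proof -
    have "Measurable.pred M (\<lambda>\<omega>. C s \<omega> \<notin> X)" if "s \<in> {1..t}" for s
    proof -
      have [measurable]: "C s \<in> measurable M (count_space UNIV)"
        using that by (intro coupon_measurable) auto
      show ?thesis by measurable
    qed
    then show ?thesis by measurable
  qed
  have "prob {\<omega> \<in> space M. missing n (c \<omega>) 0 t = 0} =
      expectation (indicator {\<omega> \<in> space M. missing n (c \<omega>) 0 t = 0})"
    by (simp add: Int_def conj_commute)
  also have "\<dots> = expectation (\<lambda>\<omega>. \<Sum>X\<in>Pow {1..n}. (-1) ^ card X *
                   indicator {\<omega> \<in> space M. \<forall>s\<in>{1..t}. C s \<omega> \<notin> X} \<omega>)"
    by (intro Bochner_Integration.integral_cong refl)
       (auto simp: ind prod_u finite_subset intro!: sum.cong)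
  also have "\<dots> = (\<Sum>X\<in>Pow {1..n}. (-1) ^ card X * prob {\<omega> \<in> space M. \<forall>s\<in>{1..t}. C s \<omega> \<notin> X})"
    by (subst Bochner_Integration.integral_sum)
       (auto simp: Int_def conj_commute intro!: integrable_indicator_event)
  also have "\<dots> = (\<Sum>X\<in>Pow {1..n}. (-1) ^ card X * (1 - card X / n) ^ t)"
    by (intro sum.cong refl arg_cong2[where f = "(*)"] prob_avoid) auto
  also have "Pow {1..n} = {X. X \<subseteq> {1..n} \<and> card X \<in> {..n}}"
    using card_mono[of "{1..n}"] by auto
  also have "(\<Sum>X | X \<subseteq> {1..n} \<and> card X \<in> {..n}. (-1) ^ card X * (1 - card X / n) ^ t) =
      (\<Sum>j\<le>n. real (card {1..n} choose j) * ((-1) ^ j * (1 - j / n) ^ t))"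
    by (rule sum_over_subsets_by_card) auto
  finally show ?thesis by (simp add: c_def mult_ac)
qed

text \<open>
  Events about the number of copies are decomposed according to the exact set of times at which the
  type arrives, because the probability of such an event is a product over the times.
\<close>

definition pattern :: "nat \<Rightarrow> nat \<Rightarrow> nat set \<Rightarrow> 'a set" where
  "pattern i t A = {\<omega> \<in> space M. {s \<in> {1..t}. C s \<omega> = i} = A}"

abbreviation small_sets :: "nat \<Rightarrow> nat \<Rightarrow> nat set set" where
  "small_sets r t \<equiv> {A. A \<subseteq> {1..t} \<and> card A \<in> {..r}}"

lemma pattern_eq:
  assumes "A \<subseteq> {1..t}"
  shows "pattern i t A = {\<omega> \<in> space M. \<forall>s\<in>{1..t}. C s \<omega> = i \<longleftrightarrow> s \<in> A}"
  using assms by (auto simp: pattern_def)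

lemma pattern_sets [measurable]:
  assumes "A \<subseteq> {1..t}"
  shows "pattern i t A \<in> sets M"
proof -
  have "Measurable.pred M (\<lambda>\<omega>. C s \<omega> = i \<longleftrightarrow> s \<in> A)" if "s \<in> {1..t}" for s
  proof -
    have [measurable]: "C s \<in> measurable M (count_space UNIV)"
      using that by (intro coupon_measurable) auto
    show ?thesis by (cases "s \<in> A") simp_all
  qed
  then show ?thesis by (simp add: pattern_eq[OF assms])
qed

lemma few_copies_as_patterns:
  "{\<omega> \<in> space M. copies (\<lambda>s. C s \<omega>) i t \<le> r} = (\<Union>A\<in>small_sets r t. pattern i t A)"
proof (intro equalityI subsetI)
  fix \<omega> assume "\<omega> \<in> {\<omega> \<in> space M. copies (\<lambda>s. C s \<omega>) i t \<le> r}"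
  then show "\<omega> \<in> (\<Union>A\<in>small_sets r t. pattern i t A)"
    by (intro UN_I[of "{s \<in> {1..t}. C s \<omega> = i}"]) (simp_all add: copies_def pattern_def subset_iff)
next
  fix \<omega> assume "\<omega> \<in> (\<Union>A\<in>small_sets r t. pattern i t A)"
  then obtain A where "A \<in> small_sets r t" "\<omega> \<in> pattern i t A"
    by (rule UN_E)
  then show "\<omega> \<in> {\<omega> \<in> space M. copies (\<lambda>s. C s \<omega>) i t \<le> r}"
    by (simp add: copies_def pattern_def)
qed

lemma few_copies_prob_eq:
  "few_copies_prob n r t = (\<Sum>A\<in>small_sets r t. (1 / n) ^ card A * (1 - 1 / n) ^ (t - card A))"
  using sum_over_subsets_by_card[of "{1..t}" "{..r}" "\<lambda>a. (1 / n) ^ a * (1 - 1 / n) ^ (t - a)"]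
  by (simp add: few_copies_prob_def)

lemma prob_pattern:
  assumes "i \<in> {1..n}" "A \<subseteq> {1..t}"
  shows "prob (pattern i t A) = (1 / n) ^ card A * (1 - 1 / n) ^ (t - card A)"
proof -
  define B where "B s = (if s \<in> A then {i} else - {i})" for s
  have "pattern i t A = {\<omega> \<in> space M. \<forall>s\<in>{1..t}. C s \<omega> \<in> B s}"
  proof -
    have "C s \<omega> \<in> B s \<longleftrightarrow> (C s \<omega> = i \<longleftrightarrow> s \<in> A)" for s \<omega>
      by (simp add: B_def)
    then show ?thesis by (simp add: pattern_eq[OF assms(2)])
  qed
  then have "prob (pattern i t A) = (\<Prod>s\<in>{1..t}. card ({1..n} \<inter> B s) / n)"
    using prob_coupons_in[of t B] by simp
  also have "\<dots> = (\<Prod>s\<in>{1..t}. if s \<in> A then 1 / n else 1 - 1 / n)"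
    using assms(1) n_pos
    by (intro prod.cong refl) (auto simp: B_def of_nat_diff field_simps simp flip: Diff_eq)
  also have "\<dots> = (1 / n) ^ card A * (1 - 1 / n) ^ (t - card A)"
    by (rule prod_if_mem_subset[OF assms(2)])
  finally show ?thesis .
qed

lemma prob_few_copies:
  assumes "i \<in> {1..n}"
  shows "prob {\<omega> \<in> space M. copies (\<lambda>s. C s \<omega>) i t \<le> r} = few_copies_prob n r t"
proof -
  have "finite (small_sets r t)"
    by (rule finite_subset[of _ "Pow {1..t}"]) auto
  then have "prob (\<Union>A\<in>small_sets r t. pattern i t A) = (\<Sum>A\<in>small_sets r t. prob (pattern i t A))"
  proof (rule finite_measure_finite_Union)
    show "disjoint_family_on (pattern i t) (small_sets r t)"
      by (auto simp: disjoint_family_on_def pattern_def)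
  qed (auto intro: pattern_sets)
  also have "\<dots> = few_copies_prob n r t"
    using assms by (simp add: few_copies_prob_eq prob_pattern)
  finally show ?thesis by (simp only: few_copies_as_patterns)
qed

text \<open>
  Near-independence of two types. If \<open>A\<close> and \<open>B\<close> overlap, the event is empty. Otherwise each of the
  \<open>t - |A| - |B|\<close> times outside both sets avoids two types, which has probability
  \<open>1 - 2 / n \<le> (1 - 1 / n)\<^sup>2\<close>. Compared with the product of the two single probabilities, at most
  \<open>|A| + |B| \<le> 2 r\<close> factors \<open>1 - 1 / n\<close> are missing, and the denominator compensates for them.
\<close>

lemma prob_two_patterns_le:
  assumes ij: "i \<in> {1..n}" "j \<in> {1..n}" "i \<noteq> j"
    and A: "A \<in> small_sets r t" and B: "B \<in> small_sets r t"
  defines "q \<equiv> 1 - 1 / real n"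
  shows "prob (pattern i t A \<inter> pattern j t B) \<le>
    ((1 / n) ^ card A * q ^ (t - card A)) * ((1 / n) ^ card B * q ^ (t - card B)) / q ^ (2 * r)"
proof (cases "A \<inter> B = {}")
  case False
  then have "pattern i t A \<inter> pattern j t B = {}"
    using ij(3) by (auto simp: pattern_def)
  then show ?thesis
    using n_pos by (simp add: q_def)
next
  case disj: True
  have n2: "2 \<le> n" using ij by auto
  then have q: "0 < q" "q \<le> 1" by (auto simp: q_def)
  have fin: "finite A" "finite B" using A B by (auto intro: finite_subset)
  define D where "D s = (if s \<in> A then {i} else if s \<in> B then {j} else - {i, j})" for s
  have "pattern i t A \<inter> pattern j t B = {\<omega> \<in> space M. \<forall>s\<in>{1..t}. C s \<omega> \<in> D s}"
  proof -
    have sub: "A \<subseteq> {1..t}" "B \<subseteq> {1..t}" using A B by auto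
    have "C s \<omega> \<in> D s \<longleftrightarrow> (C s \<omega> = i \<longleftrightarrow> s \<in> A) \<and> (C s \<omega> = j \<longleftrightarrow> s \<in> B)" for s \<omega>
      using ij(3) disj by (auto simp: D_def)
    then show ?thesis
      unfolding pattern_eq[OF sub(1)] pattern_eq[OF sub(2)] by (simp add: ball_conj_distrib) blast
  qed
  then have "prob (pattern i t A \<inter> pattern j t B) = (\<Prod>s\<in>{1..t}. card ({1..n} \<inter> D s) / n)"
    using prob_coupons_in[of t D] by simp
  also have "\<dots> = (\<Prod>s\<in>{1..t}. if s \<in> A \<union> B then 1 / n else 1 - 2 / n)"
    using ij n2
    by (intro prod.cong refl)
       (auto simp: D_def of_nat_diff field_simps card_Diff_subset simp flip: Diff_eq)
  also have "\<dots> = (1 / n) ^ card (A \<union> B) * (1 - 2 / n) ^ (t - card (A \<union> B))"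
    using A B by (intro prod_if_mem_subset) auto
  also have "card (A \<union> B) = card A + card B"
    using fin disj by (simp add: card_Un_disjoint)
  also have "(1 - 2 / real n) ^ (t - (card A + card B)) \<le> (q ^ 2) ^ (t - (card A + card B))"
    using n2 by (intro power_mono) (auto simp: q_def power2_eq_square field_simps)
  also have "(q ^ 2) ^ (t - (card A + card B)) \<le> q ^ (t - card A) * q ^ (t - card B) / q ^ (2 * r)"
  proof -
    have "card A + card B \<le> t"
      using A B fin disj card_mono[of "{1..t}" "A \<union> B"] by (simp add: card_Un_disjoint)
    then have e: "2 * (t - (card A + card B)) + (card A + card B) = (t - card A) + (t - card B)"
      by simp
    have "(q ^ 2) ^ (t - (card A + card B)) * q ^ (2 * r) \<le>
          (q ^ 2) ^ (t - (card A + card B)) * q ^ (card A + card B)"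
      using A B q by (intro mult_left_mono power_decreasing) auto
    also have "\<dots> = q ^ (t - card A) * q ^ (t - card B)"
      unfolding power_mult[symmetric] power_add[symmetric] e by simp
    finally show ?thesis using q by (simp add: field_simps)
  qed
  finally show ?thesis
    using n2 by (simp add: power_add mult_ac mult_left_mono)
qed

lemma prob_two_few_copies_le:
  assumes ij: "i \<in> {1..n}" "j \<in> {1..n}" "i \<noteq> j"
  shows "prob {\<omega> \<in> space M. copies (\<lambda>s. C s \<omega>) i t \<le> r \<and> copies (\<lambda>s. C s \<omega>) j t \<le> r}
    \<le> few_copies_prob n r t ^ 2 / (1 - 1 / n) ^ (2 * r)"
proof -
  define S where "S = small_sets r t"
  define w where "w A = (1 / n) ^ card A * (1 - 1 / n) ^ (t - card A)" for A :: "nat set"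
  define F where "F p = pattern i t (fst p) \<inter> pattern j t (snd p)" for p
  have fin: "finite (S \<times> S)"
    unfolding S_def by (intro finite_cartesian_product; rule finite_subset[of _ "Pow {1..t}"]) auto
  have F_sets: "F ` (S \<times> S) \<subseteq> sets M"
    by (auto simp: F_def S_def intro!: sets.Int pattern_sets)
  have "{\<omega> \<in> space M. copies (\<lambda>s. C s \<omega>) i t \<le> r \<and> copies (\<lambda>s. C s \<omega>) j t \<le> r} =
      {\<omega> \<in> space M. copies (\<lambda>s. C s \<omega>) i t \<le> r} \<inter> {\<omega> \<in> space M. copies (\<lambda>s. C s \<omega>) j t \<le> r}"
    by auto
  also have "\<dots> = (\<Union>A\<in>S. pattern i t A) \<inter> (\<Union>B\<in>S. pattern j t B)"
    by (simp only: few_copies_as_patterns S_def)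
  also have "\<dots> = (\<Union>p\<in>S \<times> S. F p)"
    unfolding F_def by fastforce
  also have "prob \<dots> \<le> (\<Sum>p\<in>S \<times> S. prob (F p))"
    by (rule finite_measure_subadditive_finite[OF fin F_sets])
  also have "\<dots> \<le> (\<Sum>p\<in>S \<times> S. w (fst p) * w (snd p) / (1 - 1 / n) ^ (2 * r))"
    unfolding F_def w_def S_def by (intro sum_mono prob_two_patterns_le[OF ij]) (simp_all only: mem_Times_iff)
  also have "\<dots> = few_copies_prob n r t ^ 2 / (1 - 1 / n) ^ (2 * r)"
    unfolding few_copies_prob_eq power2_eq_square sum_product sum.cartesian_product sum_divide_distrib
    by (simp only: S_def w_def case_prod_beta)
  finally show ?thesis .
qed

lemma missing_as_sum:
  assumes "\<omega> \<in> space M"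
  shows "real (missing n (\<lambda>s. C s \<omega>) r t) =
    (\<Sum>i\<in>{1..n}. indicator {\<omega> \<in> space M. copies (\<lambda>s. C s \<omega>) i t \<le> r} \<omega>)"
  using assms by (simp add: missing_def indicator_def sum.If_cases Int_def conj_commute)

lemma integrable_missing: "integrable M (\<lambda>\<omega>. real (missing n (\<lambda>s. C s \<omega>) r t))"
  by (rule integrable_const_bound[where B = n]) (auto simp: missing_le)

lemma integrable_missing_sq: "integrable M (\<lambda>\<omega>. real (missing n (\<lambda>s. C s \<omega>) r t) ^ 2)"
  by (rule integrable_const_bound[where B = "real n ^ 2"]) (auto simp: missing_le intro!: power_mono)

lemma expectation_missing:
  "expectation (\<lambda>\<omega>. real (missing n (\<lambda>s. C s \<omega>) r t)) = n * few_copies_prob n r t"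
proof -
  define E where "E i = {\<omega> \<in> space M. copies (\<lambda>s. C s \<omega>) i t \<le> r}" for i
  have [simp, measurable]: "E i \<in> sets M" for i unfolding E_def by measurable
  have "expectation (\<lambda>\<omega>. real (missing n (\<lambda>s. C s \<omega>) r t)) =
    expectation (\<lambda>\<omega>. \<Sum>i\<in>{1..n}. indicator (E i) \<omega>)"
    unfolding E_def by (intro Bochner_Integration.integral_cong refl missing_as_sum)
  also have "\<dots> = (\<Sum>i\<in>{1..n}. expectation (indicator (E i)))"
    by (intro Bochner_Integration.integral_sum integrable_indicator_event) simp
  also have "\<dots> = (\<Sum>i\<in>{1..n}. prob (E i))"
    by simp
  also have "\<dots> = n * few_copies_prob n r t"
    by (simp add: prob_few_copies E_def)
  finally show ?thesis .
qed

text \<open>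
  The second moment is a sum over pairs of types. The diagonal contributes the mean, and the
  off-diagonal part is nearly the square of the mean; the denominator tends to \<open>1\<close> as \<open>n\<close> grows
  with \<open>r\<close> fixed.
\<close>

lemma expectation_missing_sq_le:
  "expectation (\<lambda>\<omega>. real (missing n (\<lambda>s. C s \<omega>) r t) ^ 2)
    \<le> n * few_copies_prob n r t + (n * few_copies_prob n r t) ^ 2 / (1 - 1 / n) ^ (2 * r)"
proof -
  define E where "E i = {\<omega> \<in> space M. copies (\<lambda>s. C s \<omega>) i t \<le> r}" for i
  have [simp, measurable]: "E i \<in> sets M" for i unfolding E_def by measurable
  have "expectation (\<lambda>\<omega>. real (missing n (\<lambda>s. C s \<omega>) r t) ^ 2) =
    expectation (\<lambda>\<omega>. \<Sum>i\<in>{1..n}. \<Sum>j\<in>{1..n}. indicator (E i \<inter> E j) \<omega>)"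
    by (intro Bochner_Integration.integral_cong refl)
       (simp only: missing_as_sum power2_eq_square sum_product indicator_inter_arith E_def)
  also have "\<dots> = (\<Sum>i\<in>{1..n}. expectation (\<lambda>\<omega>. \<Sum>j\<in>{1..n}. indicator (E i \<inter> E j) \<omega>))"
    by (intro Bochner_Integration.integral_sum Bochner_Integration.integrable_sum
        integrable_indicator_event) simp
  also have "\<dots> = (\<Sum>i\<in>{1..n}. \<Sum>j\<in>{1..n}. expectation (indicator (E i \<inter> E j)))"
    by (intro sum.cong refl Bochner_Integration.integral_sum integrable_indicator_event) simp
  also have "\<dots> = (\<Sum>i\<in>{1..n}. \<Sum>j\<in>{1..n}. prob (E i \<inter> E j))"
    by (intro sum.cong refl) simp
  also have "\<dots> \<le> (\<Sum>i\<in>{1..n}. \<Sum>j\<in>{1..n}. (if i = j then few_copies_prob n r t else 0) +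
                few_copies_prob n r t ^ 2 / (1 - 1 / n) ^ (2 * r))"
  proof (intro sum_mono)
    fix i j assume ij: "i \<in> {1..n}" "j \<in> {1..n}"
    have "0 \<le> few_copies_prob n r t ^ 2 / (1 - 1 / n) ^ (2 * r)"
      using n_pos by simp
    moreover have "prob (E i) = few_copies_prob n r t"
      using ij prob_few_copies by (simp add: E_def)
    moreover have "E i \<inter> E j =
        {\<omega> \<in> space M. copies (\<lambda>s. C s \<omega>) i t \<le> r \<and> copies (\<lambda>s. C s \<omega>) j t \<le> r}"
      by (auto simp: E_def)
    ultimately show "prob (E i \<inter> E j) \<le> (if i = j then few_copies_prob n r t else 0) +
                few_copies_prob n r t ^ 2 / (1 - 1 / n) ^ (2 * r)"
      using prob_two_few_copies_le[OF ij, of t r] by (cases "i = j") auto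
  qed
  also have "\<dots> = n * few_copies_prob n r t + (n * few_copies_prob n r t) ^ 2 / (1 - 1 / n) ^ (2 * r)"
    by (simp add: sum.distrib power2_eq_square distrib_left)
  finally show ?thesis .
qed

end

section \<open>Asymptotics at the critical times\<close>

lemma binomial_ratio_limit:
  fixes m :: "nat \<Rightarrow> nat" and s :: "nat \<Rightarrow> real"
  assumes s: "filterlim s at_top sequentially" and ms: "(\<lambda>n. real (m n) / s n) \<longlonglongrightarrow> 1"
  shows "(\<lambda>n. real (m n choose a) / s n ^ a) \<longlonglongrightarrow> 1 / fact a"
proof -
  have eq: "real (m n choose a) / s n ^ a = (\<Prod>i<a. real (m n) / s n - real i / s n) / fact a" for n
    by (simp add: binomial_gbinomial gbinomial_prod_rev prod_dividef lessThan_atLeast0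
             flip: diff_divide_distrib)
  have "(\<lambda>n. real i / s n) \<longlonglongrightarrow> 0" for i :: nat
    by (rule real_tendsto_divide_at_top[OF tendsto_const s])
  then have "(\<lambda>n. (\<Prod>i<a. real (m n) / s n - real i / s n) / fact a) \<longlonglongrightarrow> (\<Prod>i<a. 1 - 0) / fact a"
    by (intro tendsto_divide tendsto_prod tendsto_diff ms tendsto_const) auto
  then show ?thesis by (simp add: eq)
qed

lemma n_ln_n_at_top: "filterlim (\<lambda>n::nat. real n * ln (real n)) at_top sequentially"
  by real_asymp

text \<open>
  The times \<open>t n = n ln (n / z) + o(n)\<close>, at which the expected number of unseen types tends to \<open>z\<close>.
\<close>

locale critical_times =
  fixes z :: real and t :: "nat \<Rightarrow> nat"
  assumes z_pos: "z > 0"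
    and t_lim: "(\<lambda>n. real (t n) / real n - ln (real n)) \<longlonglongrightarrow> - ln z"
begin

text \<open>
  The \<open>j\<close>-th factorial moment of the number of unseen types is asymptotic to this sequence, so the
  limits \<open>z\<^sup>j\<close> are the moments that make a Poisson limit with mean \<open>z\<close> appear.
  With \<open>t n = n (ln n + y n)\<close> the logarithm is \<open>ln n * (j + n ln (1 - j / n)) + y n * n ln (1 - j / n)\<close>,
  where the first summand vanishes in the limit and the second tends to \<open>j ln z\<close>.
\<close>

lemma power_avoid_limit:
  "(\<lambda>n. real n ^ j * (1 - real j / real n) ^ t n) \<longlonglongrightarrow> z ^ j"
proof -
  define x where "x = real j"
  have 1: "(\<lambda>n::nat. ln (real n) * (x + real n * ln (1 - x / real n))) \<longlonglongrightarrow> 0"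
    by real_asymp
  have 2: "(\<lambda>n::nat. real n * ln (1 - x / real n)) \<longlonglongrightarrow> - x"
    by real_asymp
  have "(\<lambda>n. exp (ln (real n) * (x + real n * ln (1 - x / real n)) +
           (real (t n) / real n - ln (real n)) * (real n * ln (1 - x / real n)))) \<longlonglongrightarrow> exp (0 + (- ln z) * (- x))"
    by (intro tendsto_exp tendsto_add tendsto_mult 1 2 t_lim)
  also have "exp (0 + (- ln z) * (- x)) = z ^ j"
    using z_pos by (simp add: x_def mult.commute[of "ln z"] exp_of_nat_mult)
  finally show ?thesis
  proof (rule Lim_transform_eventually)
    show "\<forall>\<^sub>F n in sequentially. exp (ln (real n) * (x + real n * ln (1 - x / real n)) +
           (real (t n) / real n - ln (real n)) * (real n * ln (1 - x / real n)))
        = real n ^ j * (1 - real j / real n) ^ t n"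
      using eventually_gt_at_top[of j]
    proof eventually_elim
      case (elim n)
      then have pos: "0 < 1 - x / real n" "0 < real n" by (auto simp: x_def)
      have "ln (real n) * (x + real n * ln (1 - x / real n)) +
           (real (t n) / real n - ln (real n)) * (real n * ln (1 - x / real n))
         = real j * ln (real n) + real (t n) * ln (1 - x / real n)"
        using pos by (simp add: field_simps x_def)
      then show ?case
        using pos by (simp add: exp_add exp_of_nat_mult) (simp add: x_def)
    qed
  qed
qed

lemma t_ratio_limit: "(\<lambda>n. real (t n) / (real n * ln (real n))) \<longlonglongrightarrow> 1"
proof -
  have "(\<lambda>n::nat. 1 / ln (real n)) \<longlonglongrightarrow> 0" by real_asymp
  then have "(\<lambda>n. 1 + (real (t n) / real n - ln (real n)) * (1 / ln (real n))) \<longlonglongrightarrow> 1 + (- ln z) * 0"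
    by (intro tendsto_intros t_lim)
  then show ?thesis
  proof (rule Lim_transform_eventually[OF _ _, THEN tendsto_eq_rhs])
    show "\<forall>\<^sub>F n in sequentially. 1 + (real (t n) / real n - ln (real n)) * (1 / ln (real n)) =
            real (t n) / (real n * ln (real n))"
      using eventually_gt_at_top[of 1] by eventually_elim (simp add: field_simps)
  qed simp
qed

lemma t_at_top: "filterlim t at_top sequentially"
proof -
  have "filterlim (\<lambda>n. real (t n) / (real n * ln (real n)) * (real n * ln (real n))) at_top sequentially"
    by (rule filterlim_tendsto_pos_mult_at_top[OF t_ratio_limit _ n_ln_n_at_top]) simp
  then have "filterlim (\<lambda>n. real (t n)) at_top sequentially"
  proof (rule filterlim_mono_eventually[OF _ order_refl order_refl])
    show "\<forall>\<^sub>F n in sequentially. real (t n) / (real n * ln (real n)) * (real n * ln (real n)) = real (t n)"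
      using eventually_gt_at_top[of 1] by eventually_elim simp
  qed
  then show ?thesis by (simp add: filterlim_sequentially_iff_filterlim_real)
qed

text \<open>
  Having exactly \<open>a\<close> copies is about \<open>(ln n)\<^sup>a / a!\<close> times as likely as having none, because the
  number of copies is nearly Poisson with mean \<open>t / n\<close>, which is asymptotic to \<open>ln n\<close>. After division by
  \<open>(ln n)\<^sup>r\<close> only \<open>a = r\<close> survives.
\<close>

lemma few_copies_limit:
  assumes "r \<ge> 1"
  shows "(\<lambda>n. fact r / ln (real n) ^ r *
           (real n * few_copies_prob n r (t n))) \<longlonglongrightarrow> z"
proof -
  define b where "b n a = real (t n choose a) / (real n * ln (real n)) ^ a" for n a
  have "(\<lambda>n. fact r / ln (real n) ^ (r - a) * b n a * (real n * (1 - 1 / real n) ^ t n) / (1 - 1 / real n) ^ a)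
      \<longlonglongrightarrow> (if a = r then fact r else 0) * (1 / fact a) * z / 1 ^ a" if "a \<le> r" for a
  proof -
    have "(\<lambda>n. fact r / ln (real n) ^ (r - a)) \<longlonglongrightarrow> (if a = r then fact r else 0)"
    proof (cases "a = r")
      case False
      then have "r - a > 0" using that by simp
      moreover have "filterlim (\<lambda>n::nat. ln (real n)) at_top sequentially" by real_asymp
      ultimately have "filterlim (\<lambda>n::nat. ln (real n) ^ (r - a)) at_top sequentially"
        by (intro filterlim_pow_at_top)
      then show ?thesis using False by (simp add: real_tendsto_divide_at_top[OF tendsto_const])
    qed simp
    moreover have "(\<lambda>n. b n a) \<longlonglongrightarrow> 1 / fact a"
      unfolding b_def by (rule binomial_ratio_limit[OF n_ln_n_at_top t_ratio_limit])
    moreover have "(\<lambda>n. real n * (1 - 1 / real n) ^ t n) \<longlonglongrightarrow> z"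
      using power_avoid_limit[of 1] by simp
    moreover have "(\<lambda>n::nat. 1 - 1 / real n) \<longlonglongrightarrow> 1" by real_asymp
    ultimately show ?thesis by (intro tendsto_intros) auto
  qed
  then have "(\<lambda>n. \<Sum>a\<le>r. fact r / ln (real n) ^ (r - a) * b n a * (real n * (1 - 1 / real n) ^ t n) / (1 - 1 / real n) ^ a)
      \<longlonglongrightarrow> (\<Sum>a\<le>r. (if a = r then fact r else 0) * (1 / fact a) * z / 1 ^ a)"
    by (intro tendsto_sum) auto
  also have "(\<Sum>a\<le>r. (if a = r then fact r else 0) * (1 / fact a) * z / 1 ^ a) = (\<Sum>a\<le>r. if a = r then z else 0)"
    by (intro sum.cong) auto
  also have "\<dots> = z" by simp
  finally show ?thesis
  proof (rule Lim_transform_eventually)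
    have "\<forall>\<^sub>F n in sequentially. r \<le> t n"
      using t_at_top by (simp add: filterlim_at_top)
    with eventually_gt_at_top[of 1]
    show "\<forall>\<^sub>F n in sequentially. (\<Sum>a\<le>r. fact r / ln (real n) ^ (r - a) * b n a * (real n * (1 - 1 / real n) ^ t n) / (1 - 1 / real n) ^ a) =
       fact r / ln (real n) ^ r * (real n * few_copies_prob n r (t n))"
    proof eventually_elim
      case (elim n)
      define q L where "q = 1 - 1 / real n" and "L = ln (real n)"
      have pos: "q > 0" "L > 0" "real n > 0" using elim by (auto simp: q_def L_def)
      have "fact r / L ^ (r - a) * b n a * (real n * q ^ t n) / q ^ a =
          fact r / L ^ r * (real n * (real (t n choose a) * ((1 / real n) ^ a * q ^ (t n - a))))"
        if "a \<le> r" for a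
      proof -
        have "L ^ r = L ^ (r - a) * L ^ a" "q ^ t n = q ^ (t n - a) * q ^ a"
          using that elim by (simp_all flip: power_add)
        then show ?thesis
          using pos by (simp add: b_def power_mult_distrib power_divide mult_ac flip: L_def)
      qed
      then show ?case
        unfolding q_def L_def few_copies_prob_def by (simp add: sum_distrib_left)
    qed
  qed
qed

text \<open>
  Termwise the inclusion-exclusion sum converges to the series of \<open>exp (- z)\<close>. The exchange of limit
  and sum is justified by \<open>(n choose j) (1 - j / n)\<^sup>t \<le> (n exp (- t / n))\<^sup>j / j!\<close>, where
  \<open>n exp (- t / n)\<close> tends to \<open>z\<close> and is therefore eventually below \<open>z + 1\<close>.
\<close>

lemma complete_prob_limit:
  "(\<lambda>n. \<Sum>j\<le>n. (-1) ^ j * real (n choose j) * (1 - real j / real n) ^ t n) \<longlonglongrightarrow> exp (- z)"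
proof -
  define a where "a j n = (if j \<le> n then (-1) ^ j * real (n choose j) * (1 - real j / real n) ^ t n else 0)" for j n
  define b where "b j = (- z) ^ j / fact j" for j
  have lim: "(\<lambda>n. a j n) \<longlonglongrightarrow> b j" for j
  proof -
    have "(\<lambda>n. real n / real n) \<longlonglongrightarrow> 1" by real_asymp
    then have "(\<lambda>n. real (n choose j) / real n ^ j) \<longlonglongrightarrow> 1 / fact j"
      by (intro binomial_ratio_limit) (auto simp: filterlim_real_sequentially)
    then have "(\<lambda>n. (-1) ^ j * (real (n choose j) / real n ^ j) * (real n ^ j * (1 - real j / real n) ^ t n))
        \<longlonglongrightarrow> (-1) ^ j * (1 / fact j) * z ^ j"
      by (intro tendsto_mult tendsto_const power_avoid_limit)
    also have "(-1) ^ j * (1 / fact j) * z ^ j = b j"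
      by (simp add: b_def power_minus[of z])
    finally show ?thesis
    proof (rule Lim_transform_eventually)
      show "\<forall>\<^sub>F n in sequentially. (-1) ^ j * (real (n choose j) / real n ^ j) * (real n ^ j * (1 - real j / real n) ^ t n) = a j n"
        using eventually_gt_at_top[of j] by eventually_elim (simp add: a_def)
    qed
  qed
  have "(\<lambda>n. exp (- (real (t n) / real n - ln (real n)))) \<longlonglongrightarrow> exp (- (- ln z))"
    by (intro tendsto_intros t_lim)
  then have "\<forall>\<^sub>F n in sequentially. exp (- (real (t n) / real n - ln (real n))) < z + 1"
    using z_pos by (intro order_tendstoD(2)) auto
  then have "\<forall>\<^sub>F n in sequentially. \<forall>j. norm (a j n) \<le> (z + 1) ^ j / fact j"
    using eventually_gt_at_top[of 0]
  proof eventually_elim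
    case (elim n)
    show ?case
    proof
      fix j
      show "norm (a j n) \<le> (z + 1) ^ j / fact j"
      proof (cases "j \<le> n")
        case True
        have "real ((n choose j) * fact j) \<le> real (n ^ j)"
          using binomial_fact_pow[of n j] by (simp only: of_nat_le_iff)
        then have c: "real (n choose j) \<le> real n ^ j / fact j"
          by (simp add: field_simps)
        have "(1 - real j / real n) ^ t n \<le> exp (- (real j / real n)) ^ t n"
          using True elim exp_ge_add_one_self[of "- (real j / real n)"] by (intro power_mono) auto
        also have "\<dots> = exp (- real (t n) / real n) ^ j"
          by (simp flip: exp_of_nat_mult)
        finally have e: "(1 - real j / real n) ^ t n \<le> exp (- real (t n) / real n) ^ j" .
        have "norm (a j n) = real (n choose j) * (1 - real j / real n) ^ t n"
          using True elim by (simp add: a_def abs_mult power_abs)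
        also have "\<dots> \<le> (real n ^ j / fact j) * exp (- real (t n) / real n) ^ j"
          using True elim by (intro mult_mono c e) auto
        also have "\<dots> = exp (- (real (t n) / real n - ln (real n))) ^ j / fact j"
        proof -
          have "exp (- (real (t n) / real n - ln (real n))) = exp (ln (real n)) * exp (- real (t n) / real n)"
            by (simp flip: exp_add)
          then show ?thesis using elim(2) by (simp add: power_mult_distrib)
        qed
        also have "\<dots> \<le> (z + 1) ^ j / fact j"
          using elim by (intro divide_right_mono power_mono) auto
        finally show ?thesis .
      next
        case False
        then show ?thesis using z_pos by (simp add: a_def)
      qed
    qed
  qed
  then have bound: "\<forall>\<^sub>F (j, n) in sequentially \<times>\<^sub>F sequentially. norm (a j n) \<le> (z + 1) ^ j / fact j"
    unfolding eventually_prod_filter by (intro exI[of _ "\<lambda>_. True"] exI conjI) auto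
  have "summable (\<lambda>j. (z + 1) ^ j / fact j)"
    using summable_exp[of "z + 1"] by (simp add: divide_inverse_commute)
  from tannerys_theorem[OF lim bound this]
  have "(\<lambda>n. \<Sum>j. a j n) \<longlonglongrightarrow> (\<Sum>j. b j)" by simp
  moreover have "(\<Sum>j. b j) = exp (- z)"
    by (simp add: b_def exp_def divide_inverse_commute)
  moreover have "(\<Sum>j. a j n) = (\<Sum>j\<le>n. (-1) ^ j * real (n choose j) * (1 - real j / real n) ^ t n)" for n
    by (subst suminf_finite[of "{..n}"]) (auto simp: a_def)
  ultimately show ?thesis by simp
qed

end

lemma critical_times_stage:
  assumes "z > 0"
  shows "critical_times z (stage z)"
proof
  show "(\<lambda>n. real (stage z n) / real n - ln (real n)) \<longlonglongrightarrow> - ln z"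
  proof (rule tendsto_sandwich)
    show "(\<lambda>n. - ln z - 1 / real n) \<longlonglongrightarrow> - ln z" by real_asymp
    show "(\<lambda>n. - ln z) \<longlonglongrightarrow> - ln z" by simp
    have "\<forall>\<^sub>F n in sequentially. z \<le> real n \<and> 0 < n"
      using eventually_ge_at_top[of "nat \<lceil>z\<rceil>"] eventually_gt_at_top[of 0]
      by eventually_elim (simp add: nat_le_iff ceiling_le_iff)
    then have *: "\<forall>\<^sub>F n in sequentially. - ln z - 1 / real n \<le> real (stage z n) / real n - ln (real n) \<and>
        real (stage z n) / real n - ln (real n) \<le> - ln z"
    proof eventually_elim
      case (elim n)
      define x where "x = real n * ln (real n / z)"
      have "0 \<le> x" using elim assms by (simp add: x_def)
      then have s: "real (stage z n) = real_of_int \<lfloor>x\<rfloor>" by (simp add: stage_def x_def)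
      have x: "x / real n = ln (real n) - ln z" using elim assms by (simp add: x_def ln_div)
      have "(x - 1) / real n \<le> real (stage z n) / real n" "real (stage z n) / real n \<le> x / real n"
        using s by (intro divide_right_mono; linarith; simp)+
      then show ?case using x by (simp add: diff_divide_distrib)
    qed
    then show "\<forall>\<^sub>F n in sequentially. - ln z - 1 / real n \<le> real (stage z n) / real n - ln (real n)"
      and "\<forall>\<^sub>F n in sequentially. real (stage z n) / real n - ln (real n) \<le> - ln z"
      by (auto elim: eventually_mono)
  qed
qed (fact assms)

section \<open>Convergence in distribution to a constant sequence\<close>

lemma tendsto_fun_iff:
  fixes f :: "'b \<Rightarrow> 'i \<Rightarrow> 'a::topological_space"
  shows "(f \<longlongrightarrow> l) F \<longleftrightarrow> (\<forall>i. ((\<lambda>x. f x i) \<longlongrightarrow> l i) F)"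
  using limitin_componentwise[of "\<lambda>_. euclidean" UNIV f l F]
  by (simp add: euclidean_product_topology)

text \<open>
  Continuity alone is not uniform, but the constant sequences with values in \<open>[-K, K]\<close> form a compact
  set in the product topology, and near a compact set continuity is uniform. A single index \<open>m\<close>
  measures closeness: it bounds both the number of coordinates that are controlled and the precision.
  If no \<open>m\<close> worked, a convergent subsequence of the offending values \<open>z\<close> would contradict
  continuity at its limit.
\<close>

lemma continuous_near_constant_sequences:
  fixes f :: "(nat \<Rightarrow> real) \<Rightarrow> real"
  assumes f: "continuous_on UNIV f" and "\<epsilon> > 0"
  shows "\<exists>m. \<forall>z y. \<bar>z\<bar> \<le> K \<longrightarrow> (\<forall>k<m. \<bar>y k - z\<bar> \<le> 1 / real (Suc m)) \<longrightarrow> \<bar>f y - f (\<lambda>_. z)\<bar> < \<epsilon>"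
proof (rule ccontr)
  assume "\<not> ?thesis"
  then have "\<forall>m. \<exists>z y. \<bar>z\<bar> \<le> K \<and> (\<forall>k<m. \<bar>y k - z\<bar> \<le> 1 / real (Suc m)) \<and> \<epsilon> \<le> \<bar>f y - f (\<lambda>_. z)\<bar>"
    by (auto simp: not_less)
  then obtain z y where zK: "\<And>m. \<bar>z m\<bar> \<le> K"
    and yz: "\<And>m k. k < m \<Longrightarrow> \<bar>y m k - z m\<bar> \<le> 1 / real (Suc m)"
    and far: "\<And>m. \<epsilon> \<le> \<bar>f (y m) - f (\<lambda>_. z m)\<bar>"
    by metis
  have "seq_compact {- K..K}" by (intro compact_imp_seq_compact) simp
  moreover have "\<forall>m. z m \<in> {-K..K}" using zK by (auto simp: abs_le_iff minus_le_iff)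
  ultimately obtain l s where s: "strict_mono s" and zl: "(z \<circ> s) \<longlonglongrightarrow> l"
    by (auto elim!: seq_compactE)
  have s_top: "filterlim s at_top sequentially" by (rule filterlim_subseq[OF s])
  have diff: "(\<lambda>p. y (s p) k - z (s p)) \<longlonglongrightarrow> 0" for k
  proof (rule Lim_null_comparison)
    show "\<forall>\<^sub>F p in sequentially. norm (y (s p) k - z (s p)) \<le> 1 / real (Suc (s p))"
      using eventually_compose_filterlim[OF eventually_gt_at_top[of k] s_top]
      by eventually_elim (use yz in auto)
    show "(\<lambda>p. 1 / real (Suc (s p))) \<longlonglongrightarrow> 0"
      using filterlim_compose[OF LIMSEQ_inverse_real_of_nat s_top] by (simp add: inverse_eq_divide)
  qed
  have "(\<lambda>p. y (s p)) \<longlonglongrightarrow> (\<lambda>_. l)"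
    unfolding tendsto_fun_iff using tendsto_add[OF diff zl] by (simp add: o_def)
  then have 1: "(\<lambda>p. f (y (s p))) \<longlonglongrightarrow> f (\<lambda>_. l)"
    by (rule continuous_on_tendsto_compose[OF f]) auto
  have "(\<lambda>p. (\<lambda>_::nat. z (s p))) \<longlonglongrightarrow> (\<lambda>_. l)"
    unfolding tendsto_fun_iff using zl by (simp add: o_def)
  then have 2: "(\<lambda>p. f (\<lambda>_. z (s p))) \<longlonglongrightarrow> f (\<lambda>_. l)"
    by (rule continuous_on_tendsto_compose[OF f]) auto
  have "(\<lambda>p. \<bar>f (y (s p)) - f (\<lambda>_. z (s p))\<bar>) \<longlonglongrightarrow> 0"
    using tendsto_rabs[OF tendsto_diff[OF 1 2]] by simp
  then have "\<epsilon> \<le> 0"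
    by (rule tendsto_lowerbound) (use far in auto)
  with \<open>\<epsilon> > 0\<close> show False by simp
qed

text \<open>
  The functions \<open>g K\<close> in the proof interpolate continuously between the events \<open>|x| > K\<close> and
  \<open>|x| > K + 1\<close>, so that weak convergence transfers a tail bound from the limit to the sequence.
\<close>

lemma conv_in_distribution_tight:
  fixes Z :: "nat \<Rightarrow> 'a \<Rightarrow> real"
  assumes M: "\<forall>\<^sub>F n in sequentially. prob_space (M n)" and N: "prob_space N"
    and conv: "conv_in_distribution M Z N Y" and "\<epsilon> > 0"
  shows "\<exists>K. \<forall>\<^sub>F n in sequentially. measure (M n) {\<omega> \<in> space (M n). \<bar>Z n \<omega>\<bar> > K} < \<epsilon>"
proof -
  interpret N: prob_space N by fact
  have [measurable]: "Y \<in> borel_measurable N"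
    using conv by (simp add: conv_in_distribution_def)
  define g :: "real \<Rightarrow> real \<Rightarrow> real" where "g K x = max 0 (min 1 (\<bar>x\<bar> - K))" for K x
  have g_cont: "continuous_on UNIV (g K)" for K
    unfolding g_def by (intro continuous_intros)
  have [measurable]: "g K \<in> borel_measurable borel" for K
    by (rule borel_measurable_continuous_onI[OF g_cont])
  have g_bds: "0 \<le> g K x" "g K x \<le> 1" for K x by (auto simp: g_def)
  have "(\<lambda>j. \<integral>\<omega>. g (real j) (Y \<omega>) \<partial>N) \<longlonglongrightarrow> (\<integral>\<omega>. 0 \<partial>N)"
  proof (rule integral_dominated_convergence[where w = "\<lambda>_. 1"])
    show "AE \<omega> in N. (\<lambda>j. g (real j) (Y \<omega>)) \<longlonglongrightarrow> 0"
    proof (rule AE_I2)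
      fix \<omega>
      have "\<forall>\<^sub>F j in sequentially. g (real j) (Y \<omega>) = 0"
        using eventually_ge_at_top[of "nat \<lceil>\<bar>Y \<omega>\<bar>\<rceil>"]
        by eventually_elim (auto simp: g_def max_def min_def nat_le_iff ceiling_le_iff)
      then show "(\<lambda>j. g (real j) (Y \<omega>)) \<longlonglongrightarrow> 0" by (rule tendsto_eventually)
    qed
  qed (use g_bds in auto)
  then have "\<forall>\<^sub>F j in sequentially. (\<integral>\<omega>. g (real j) (Y \<omega>) \<partial>N) < \<epsilon>"
    using \<open>\<epsilon> > 0\<close> by (intro order_tendstoD(2)) auto
  then obtain j :: nat where j: "(\<integral>\<omega>. g (real j) (Y \<omega>) \<partial>N) < \<epsilon>"
    by (auto simp: eventually_sequentially)
  have "bounded (range (g j))"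
    using g_bds by (intro boundedI[of _ 1]) (auto simp: abs_le_iff intro: order.trans[of _ 0])
  then have "(\<lambda>n. \<integral>\<omega>. g j (Z n \<omega>) \<partial>M n) \<longlonglongrightarrow> (\<integral>\<omega>. g j (Y \<omega>) \<partial>N)"
    using conv g_cont by (auto simp: conv_in_distribution_def)
  then have "\<forall>\<^sub>F n in sequentially. (\<integral>\<omega>. g j (Z n \<omega>) \<partial>M n) < \<epsilon>"
    using j by (rule order_tendstoD(2))
  moreover have "\<forall>\<^sub>F n in sequentially. Z n \<in> borel_measurable (M n)"
    using conv by (simp add: conv_in_distribution_def)
  ultimately have "\<forall>\<^sub>F n in sequentially. measure (M n) {\<omega> \<in> space (M n). \<bar>Z n \<omega>\<bar> > real j + 1} < \<epsilon>"
    using M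
  proof eventually_elim
    case (elim n)
    interpret prob_space "M n" by (rule elim)
    note elim(2)[measurable]
    define A where "A = {\<omega> \<in> space (M n). \<bar>Z n \<omega>\<bar> > real j + 1}"
    have A [measurable]: "A \<in> sets (M n)" unfolding A_def by measurable
    have "prob A = (\<integral>\<omega>. indicator A \<omega> \<partial>M n)"
      using sets.sets_into_space[OF A] by (simp add: Int_absorb2)
    also have "\<dots> \<le> (\<integral>\<omega>. g j (Z n \<omega>) \<partial>M n)"
    proof (rule integral_mono)
      show "integrable (M n) (\<lambda>\<omega>. g (real j) (Z n \<omega>))"
        by (rule integrable_const_bound[of _ 1]) (use g_bds in auto)
      show "integrable (M n) (indicator A :: 'a \<Rightarrow> real)"
        by (rule integrable_real_indicator) (auto simp: emeasure_eq_measure)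
    qed (auto simp: A_def g_def indicator_def)
    finally show ?case using elim(1) by (simp add: A_def)
  qed
  then show ?thesis by blast
qed

text \<open>
  Slutsky's theorem for sequence-valued random elements: if every coordinate of \<open>X n\<close> differs from the
  same real random variable \<open>Z n\<close> by an amount that vanishes in probability, then \<open>X n\<close> has the same
  limit as the constant sequence \<open>(Z n, Z n, \<dots>)\<close>, to which \<open>z \<mapsto> (z, z, \<dots>)\<close> transports the limit of
  \<open>Z n\<close>. Outside an event of small probability \<open>Z n\<close> is bounded and finitely many coordinates of
  \<open>X n\<close> are close to it, which by \<open>continuous_near_constant_sequences\<close> is all that a continuous
  test function notices.
\<close>

lemma conv_in_distribution_constant_sequence:
  fixes X :: "nat \<Rightarrow> 'a \<Rightarrow> nat \<Rightarrow> real" and Z :: "nat \<Rightarrow> 'a \<Rightarrow> real"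
  assumes M: "\<forall>\<^sub>F n in sequentially. prob_space (M n)" and N: "prob_space N"
    and X: "\<forall>\<^sub>F n in sequentially. X n \<in> borel_measurable (M n)"
    and conv: "conv_in_distribution M Z N Y"
    and close: "\<And>k \<delta>. \<delta> > 0 \<Longrightarrow>
      (\<lambda>n. measure (M n) {\<omega> \<in> space (M n). \<bar>X n \<omega> k - Z n \<omega>\<bar> > \<delta>}) \<longlonglongrightarrow> 0"
  shows "conv_in_distribution M X N (\<lambda>\<omega> k. Y \<omega>)"
proof -
  have Z: "\<forall>\<^sub>F n in sequentially. Z n \<in> borel_measurable (M n)"
    and Y: "Y \<in> borel_measurable N"
    using conv by (auto simp: conv_in_distribution_def)
  have "(\<lambda>n. \<integral>\<omega>. f (X n \<omega>) \<partial>M n) \<longlonglongrightarrow> (\<integral>\<omega>. f (\<lambda>k. Y \<omega>) \<partial>N)"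
    if f: "continuous_on UNIV f" and "bounded (range f)" for f :: "(nat \<Rightarrow> real) \<Rightarrow> real"
  proof -
    define h where "h z = f (\<lambda>_. z)" for z
    have h: "continuous_on UNIV h"
      unfolding h_def by (intro continuous_on_compose2[OF f] continuous_on_coordinatewise_then_product continuous_intros) auto
    have [measurable]: "f \<in> borel_measurable borel" "h \<in> borel_measurable borel"
      by (intro borel_measurable_continuous_onI f h)+
    obtain B where "B > 0" and B: "\<And>x. \<bar>f x\<bar> \<le> B"
      using \<open>bounded (range f)\<close> by (auto simp: bounded_pos)
    then have hB: "\<And>x. \<bar>h x\<bar> \<le> B" by (simp add: h_def)
    then have "bounded (range h)" by (intro boundedI[of _ B]) auto
    with h conv have lim: "(\<lambda>n. \<integral>\<omega>. h (Z n \<omega>) \<partial>M n) \<longlonglongrightarrow> (\<integral>\<omega>. h (Y \<omega>) \<partial>N)"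
      by (auto simp: conv_in_distribution_def)
    have "(\<lambda>n. (\<integral>\<omega>. f (X n \<omega>) \<partial>M n) - (\<integral>\<omega>. h (Z n \<omega>) \<partial>M n)) \<longlonglongrightarrow> 0"
    proof (rule LIMSEQ_I)
      fix \<epsilon> :: real assume "\<epsilon> > 0"
      \<comment> \<open>The integrals differ by at most \<open>\<eta>\<close> from the good event and \<open>2 B \<eta>\<close> from the bad one.\<close>
      define \<eta> where "\<eta> = \<epsilon> / (3 + 2 * B)"
      have "\<eta> > 0" using \<open>\<epsilon> > 0\<close> \<open>B > 0\<close> by (simp add: \<eta>_def)
      obtain K where K: "\<forall>\<^sub>F n in sequentially. measure (M n) {\<omega> \<in> space (M n). \<bar>Z n \<omega>\<bar> > K} < \<eta> / 2"
        using conv_in_distribution_tight[OF M N conv, of "\<eta> / 2"] \<open>\<eta> > 0\<close> by auto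
      obtain m where m: "\<And>z y. \<bar>z\<bar> \<le> K \<Longrightarrow> (\<And>k. k < m \<Longrightarrow> \<bar>y k - z\<bar> \<le> 1 / real (Suc m)) \<Longrightarrow> \<bar>f y - h z\<bar> < \<eta>"
        using continuous_near_constant_sequences[OF f \<open>\<eta> > 0\<close>, of K] unfolding h_def by blast
      have "(\<lambda>n. \<Sum>k<m. measure (M n) {\<omega> \<in> space (M n). \<bar>X n \<omega> k - Z n \<omega>\<bar> > 1 / real (Suc m)}) \<longlonglongrightarrow> (\<Sum>k<m. 0)"
        by (intro tendsto_sum close) auto
      then have S: "\<forall>\<^sub>F n in sequentially. (\<Sum>k<m. measure (M n) {\<omega> \<in> space (M n). \<bar>X n \<omega> k - Z n \<omega>\<bar> > 1 / real (Suc m)}) < \<eta> / 2"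
        using \<open>\<eta> > 0\<close> by (intro order_tendstoD(2)) auto
      have "\<forall>\<^sub>F n in sequentially. norm ((\<integral>\<omega>. f (X n \<omega>) \<partial>M n) - (\<integral>\<omega>. h (Z n \<omega>) \<partial>M n) - 0) < \<epsilon>"
        using K S M X Z
      proof eventually_elim
        case (elim n)
        interpret prob_space "M n" by (rule elim)
        note elim(4,5)[measurable]
        have [measurable]: "(\<lambda>\<omega>. X n \<omega> k) \<in> borel_measurable (M n)" for k
          by (rule measurable_compose[OF elim(4)]) 
             (intro borel_measurable_continuous_onI continuous_on_product_coordinates)
        define bad where "bad = {\<omega> \<in> space (M n). \<bar>Z n \<omega>\<bar> > K} \<union>
          (\<Union>k<m. {\<omega> \<in> space (M n). \<bar>X n \<omega> k - Z n \<omega>\<bar> > 1 / real (Suc m)})"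
        have bad_sets [measurable]: "bad \<in> sets (M n)" unfolding bad_def by measurable
        have "prob bad \<le> prob {\<omega> \<in> space (M n). \<bar>Z n \<omega>\<bar> > K} +
            prob (\<Union>k<m. {\<omega> \<in> space (M n). \<bar>X n \<omega> k - Z n \<omega>\<bar> > 1 / real (Suc m)})"
          unfolding bad_def by (intro measure_Un_le) auto
        also have "\<dots> \<le> prob {\<omega> \<in> space (M n). \<bar>Z n \<omega>\<bar> > K} +
            (\<Sum>k<m. prob {\<omega> \<in> space (M n). \<bar>X n \<omega> k - Z n \<omega>\<bar> > 1 / real (Suc m)})"
          by (intro add_left_mono finite_measure_subadditive_finite) auto
        also have "\<dots> < \<eta>" using elim(1,2) by simp
        finally have bad: "prob bad < \<eta>" .
        have int: "integrable (M n) (\<lambda>\<omega>. f (X n \<omega>))" "integrable (M n) (\<lambda>\<omega>. h (Z n \<omega>))"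
          by (rule integrable_const_bound[of _ B]; use B hB in simp)+
        have int_bad: "integrable (M n) (\<lambda>\<omega>. \<eta> + 2 * B * indicator bad \<omega>)"
          by (intro Bochner_Integration.integrable_add integrable_mult_right integrable_real_indicator)
             (auto simp: emeasure_eq_measure)
        have pw: "\<bar>f (X n \<omega>) - h (Z n \<omega>)\<bar> \<le> \<eta> + 2 * B * indicator bad \<omega>" if "\<omega> \<in> space (M n)" for \<omega>
        proof (cases "\<omega> \<in> bad")
          case True
          have "\<bar>f (X n \<omega>) - h (Z n \<omega>)\<bar> \<le> \<bar>f (X n \<omega>)\<bar> + \<bar>h (Z n \<omega>)\<bar>" by (rule abs_triangle_ineq4)
          also have "\<dots> \<le> B + B" by (intro add_mono B hB)
          finally show ?thesis using True \<open>\<eta> > 0\<close> by simp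
        next
          case False
          then have "\<bar>f (X n \<omega>) - h (Z n \<omega>)\<bar> < \<eta>"
            using that by (intro m) (auto simp: bad_def not_less)
          then show ?thesis using False by simp
        qed
        have "\<bar>(\<integral>\<omega>. f (X n \<omega>) \<partial>M n) - (\<integral>\<omega>. h (Z n \<omega>) \<partial>M n)\<bar> = \<bar>\<integral>\<omega>. f (X n \<omega>) - h (Z n \<omega>) \<partial>M n\<bar>"
          using int by simp
        also have "\<dots> \<le> (\<integral>\<omega>. \<bar>f (X n \<omega>) - h (Z n \<omega>)\<bar> \<partial>M n)"
          by (rule integral_abs_bound)
        also have "\<dots> \<le> (\<integral>\<omega>. \<eta> + 2 * B * indicator bad \<omega> \<partial>M n)"
          using int int_bad pw by (intro integral_mono) auto
        also have "\<dots> = \<eta> + 2 * B * prob bad"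
          by (subst Bochner_Integration.integral_add)
             (auto simp: prob_space sets.sets_into_space[OF bad_sets] Int_absorb2 emeasure_eq_measure
                   intro!: integrable_mult_right integrable_real_indicator)
        also have "\<dots> \<le> \<eta> + 2 * B * \<eta>"
          using bad \<open>B > 0\<close> by simp
        also have "\<dots> < (3 + 2 * B) * \<eta>"
          using \<open>\<eta> > 0\<close> by (simp add: algebra_simps)
        also have "\<dots> = \<epsilon>" using \<open>B > 0\<close> by (simp add: \<eta>_def)
        finally show ?case by simp
      qed
      then show "\<exists>no. \<forall>n\<ge>no. norm ((\<integral>\<omega>. f (X n \<omega>) \<partial>M n) - (\<integral>\<omega>. h (Z n \<omega>) \<partial>M n) - 0) < \<epsilon>"
        by (simp add: eventually_sequentially)
    qed
    from tendsto_add[OF this lim] show ?thesis by (simp add: h_def)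
  qed
  moreover have "(\<lambda>\<omega> k::nat. Y \<omega>) \<in> borel_measurable N"
    by (intro measurable_coordinatewise_then_product Y)
  ultimately show ?thesis
    using X by (simp add: conv_in_distribution_def)
qed

text \<open>
  Upper tails with \<open>\<le>\<close> are used because for the rescaled completion time these are exactly the
  events that the collection is complete by a given time.
\<close>

lemma conv_in_distribution_realI:
  fixes Z :: "nat \<Rightarrow> 'a \<Rightarrow> real"
  assumes M: "\<forall>\<^sub>F n in sequentially. prob_space (M n)" and N: "prob_space N"
    and Z: "\<forall>\<^sub>F n in sequentially. Z n \<in> borel_measurable (M n)"
    and Y [measurable]: "Y \<in> borel_measurable N"
    and tail: "\<And>z. (\<lambda>n. measure (M n) {\<omega> \<in> space (M n). z \<le> Z n \<omega>}) \<longlonglongrightarrow>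
                     measure N {\<omega> \<in> space N. z \<le> Y \<omega>}"
  shows "conv_in_distribution M Z N Y"
proof -
  interpret N: prob_space N by fact
  obtain n0 where n0: "\<And>n. n \<ge> n0 \<Longrightarrow> prob_space (M n) \<and> Z n \<in> borel_measurable (M n)"
    using eventually_conj[OF M Z] by (auto simp: eventually_sequentially)
  \<comment> \<open>The library characterises weak convergence by the probabilities of \<open>{..x}\<close>. Upper tails are turned
    into these by negating the variables, and the shift by \<open>n0\<close> skips the finitely many indices at
    which \<open>M n\<close> need not be a probability space.\<close>
  define \<mu> where "\<mu> n = distr (M (n + n0)) borel (\<lambda>\<omega>. - Z (n + n0) \<omega>)" for n
  define \<nu> where "\<nu> = distr N borel (\<lambda>\<omega>. - Y \<omega>)"
  have ms [measurable]: "Z (n + n0) \<in> borel_measurable (M (n + n0))" for n using n0 by simp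
  have \<mu>: "real_distribution (\<mu> n)" for n
    unfolding \<mu>_def by (intro prob_space.real_distribution_distr) (use n0 in auto)
  have \<nu>: "real_distribution \<nu>"
    unfolding \<nu>_def by (intro N.real_distribution_distr) auto
  have cdf_\<mu>: "cdf (\<mu> n) x = measure (M (n + n0)) {\<omega> \<in> space (M (n + n0)). - x \<le> Z (n + n0) \<omega>}" for n x
    unfolding \<mu>_def cdf_def
    by (subst measure_distr) (auto intro!: arg_cong[where f = "measure _"])
  have cdf_\<nu>: "cdf \<nu> x = measure N {\<omega> \<in> space N. - x \<le> Y \<omega>}" for x
    unfolding \<nu>_def cdf_def
    by (subst measure_distr) (auto intro!: arg_cong[where f = "measure _"])
  have weak: "weak_conv_m \<mu> \<nu>"
    unfolding weak_conv_m_def weak_conv_def cdf_\<mu> cdf_\<nu> by (intro allI impI LIMSEQ_ignore_initial_segment tail)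
  have "(\<lambda>n. \<integral>\<omega>. f (Z n \<omega>) \<partial>M n) \<longlonglongrightarrow> (\<integral>\<omega>. f (Y \<omega>) \<partial>N)"
    if f: "continuous_on UNIV f" and bdd: "bounded (range f)" for f :: "real \<Rightarrow> real"
  proof -
    have [measurable]: "f \<in> borel_measurable borel"
      by (intro borel_measurable_continuous_onI f)
    obtain B where B: "\<And>x. norm (f x) \<le> B" using bdd by (auto simp: bounded_iff)
    have "continuous_on UNIV (\<lambda>x. f (- x))"
      by (intro continuous_on_compose2[OF f] continuous_intros) auto
    then have "(\<lambda>n. \<integral>x. f (- x) \<partial>\<mu> n) \<longlonglongrightarrow> (\<integral>x. f (- x) \<partial>\<nu>)"
      by (intro weak_conv_imp_integral_bdd_continuous_conv[OF \<mu> \<nu> weak, where B = B])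
         (use B in \<open>auto simp: continuous_on_eq_continuous_at\<close>)
    then have "(\<lambda>n. \<integral>\<omega>. f (Z (n + n0) \<omega>) \<partial>M (n + n0)) \<longlonglongrightarrow> (\<integral>\<omega>. f (Y \<omega>) \<partial>N)"
      unfolding \<mu>_def \<nu>_def by (simp add: integral_distr)
    then show ?thesis by (rule LIMSEQ_offset)
  qed
  then show ?thesis
    using Z Y by (simp add: conv_in_distribution_def)
qed

lemma (in prob_space) exponential_prob_ge:
  assumes "distributed M lborel E (exponential_density 1)"
  shows "prob {\<omega> \<in> space M. z \<le> E \<omega>} = (if 0 \<le> z then exp (- z) else 1)"
proof -
  have E [measurable]: "E \<in> borel_measurable M"
    using assms by (simp add: distributed_def)
  show ?thesis
  proof (cases "0 \<le> z")
    case True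
    have "emeasure M (E -` {z} \<inter> space M) = (\<integral>\<^sup>+x. ennreal (exponential_density 1 x) * indicator {z} x \<partial>lborel)"
      using assms by (intro distributed_emeasure) auto
    also have "\<dots> = 0" 
      by (intro nn_integral_null_set finite_imp_null_set_lborel) simp
    finally have "E -` {z} \<inter> space M \<in> null_sets M"
      by (intro null_setsI) auto
    then have ae: "AE \<omega> in M. \<omega> \<notin> E -` {z} \<inter> space M"
      by (rule AE_not_in)
    have "AE \<omega> in M. \<omega> \<in> {\<omega> \<in> space M. z \<le> E \<omega>} \<longleftrightarrow> \<omega> \<in> {\<omega> \<in> space M. z < E \<omega>}"
      using ae by eventually_elim auto
    then have "prob {\<omega> \<in> space M. z \<le> E \<omega>} = prob {\<omega> \<in> space M. z < E \<omega>}"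
      by (rule finite_measure_eq_AE) auto
    then show ?thesis
      using exponential_distributedD_gt[OF assms True] True by simp
  next
    case False
    have "prob {\<omega> \<in> space M. 0 < E \<omega>} = 1"
      using exponential_distributedD_gt[OF assms, of 0] by simp
    moreover have "prob {\<omega> \<in> space M. 0 < E \<omega>} \<le> prob {\<omega> \<in> space M. z \<le> E \<omega>}"
      using False by (intro finite_measure_mono) auto
    ultimately show ?thesis
      using False prob_le_1[of "{\<omega> \<in> space M. z \<le> E \<omega>}"] by simp
  qed
qed

section \<open>Concentration and the random completion time\<close>

lemma (in uniform_coupons) mean_square_deviation_le:
  fixes c z :: real and r t :: nat
  assumes "c \<ge> 0"
  defines "\<mu> \<equiv> c * (n * few_copies_prob n r t)"
  shows "expectation (\<lambda>\<omega>. (c * real (missing n (\<lambda>s. C s \<omega>) r t) - z) ^ 2)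
    \<le> c * \<mu> + \<mu> ^ 2 / (1 - 1 / n) ^ (2 * r) - 2 * z * \<mu> + z ^ 2"
proof -
  define W where "W \<omega> = real (missing n (\<lambda>s. C s \<omega>) r t)" for \<omega>
  have int: "integrable M W" "integrable M (\<lambda>\<omega>. W \<omega> ^ 2)"
    using integrable_missing integrable_missing_sq by (simp_all add: W_def[abs_def])
  have "expectation (\<lambda>\<omega>. (c * W \<omega> - z) ^ 2) = expectation (\<lambda>\<omega>. c ^ 2 * W \<omega> ^ 2 - 2 * z * c * W \<omega> + z ^ 2)"
    by (simp add: power2_eq_square algebra_simps)
  also have "\<dots> = c ^ 2 * expectation (\<lambda>\<omega>. W \<omega> ^ 2) - 2 * z * c * expectation W + z ^ 2"
    using int by (simp add: prob_space)
  also have "\<dots> \<le> c ^ 2 * (n * few_copies_prob n r t + (n * few_copies_prob n r t) ^ 2 / (1 - 1 / n) ^ (2 * r)) -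
      2 * z * c * (n * few_copies_prob n r t) + z ^ 2"
    unfolding W_def expectation_missing
    by (intro add_right_mono diff_right_mono mult_left_mono expectation_missing_sq_le) simp
  also have "\<dots> = c * \<mu> + \<mu> ^ 2 / (1 - 1 / n) ^ (2 * r) - 2 * z * \<mu> + z ^ 2"
    by (simp add: \<mu>_def power2_eq_square distrib_left mult_ac)
  finally show ?thesis by (simp add: W_def)
qed

lemma (in uniform_coupons) deviation_prob_le:
  fixes c z \<delta> :: real and r t :: nat
  assumes "c \<ge> 0" "\<delta> > 0"
  defines "\<mu> \<equiv> c * (n * few_copies_prob n r t)"
  shows "prob {\<omega> \<in> space M. \<delta> \<le> \<bar>c * real (missing n (\<lambda>s. C s \<omega>) r t) - z\<bar>}
    \<le> (c * \<mu> + \<mu> ^ 2 / (1 - 1 / n) ^ (2 * r) - 2 * z * \<mu> + z ^ 2) / \<delta> ^ 2"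
proof -
  define u where "u \<omega> = (c * real (missing n (\<lambda>s. C s \<omega>) r t) - z) ^ 2" for \<omega>
  have u: "integrable M u"
  proof -
    have "u = (\<lambda>\<omega>. c ^ 2 * real (missing n (\<lambda>s. C s \<omega>) r t) ^ 2 - 2 * z * c * real (missing n (\<lambda>s. C s \<omega>) r t) + z ^ 2)"
      by (simp add: u_def fun_eq_iff power2_eq_square algebra_simps)
    then show ?thesis using integrable_missing integrable_missing_sq by simp
  qed
  have "{\<omega> \<in> space M. \<delta> \<le> \<bar>c * real (missing n (\<lambda>s. C s \<omega>) r t) - z\<bar>} = {\<omega> \<in> space M. \<delta> ^ 2 \<le> u \<omega>}"
    using \<open>\<delta> > 0\<close> by (auto simp: u_def abs_le_square_iff[symmetric])
  also have "prob \<dots> \<le> expectation u / \<delta> ^ 2"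
    by (rule integral_Markov_inequality_measure[OF u, of "{}"]) (use \<open>\<delta> > 0\<close> in \<open>auto simp: u_def\<close>)
  also have "\<dots> \<le> (c * \<mu> + \<mu> ^ 2 / (1 - 1 / n) ^ (2 * r) - 2 * z * \<mu> + z ^ 2) / \<delta> ^ 2"
    unfolding u_def \<mu>_def by (intro divide_right_mono mean_square_deviation_le assms) simp
  finally show ?thesis .
qed

text \<open>
  The normalised count has mean tending to \<open>z\<close> and second moment tending to \<open>z\<^sup>2\<close>, hence it
  converges to \<open>z\<close> in mean square. For \<open>r \<ge> 1\<close> the normalising factor tends to \<open>0\<close>, which removes the
  diagonal part of the second moment; for \<open>r = 0\<close> it would not, in accordance with the Poisson
  limit there.
\<close>

lemma missing_concentration:
  assumes coupons: "\<And>n. n \<ge> 1 \<Longrightarrow> uniform_coupons (M n) n (C n)"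
    and "critical_times z t" and "r \<ge> 1" and "\<delta> > 0"
  shows "(\<lambda>n. measure (M n) {\<omega> \<in> space (M n).
            \<delta> \<le> \<bar>fact r / ln (real n) ^ r * real (missing n (\<lambda>s. C n s \<omega>) r (t n)) - z\<bar>}) \<longlonglongrightarrow> 0"
proof -
  define c :: "nat \<Rightarrow> real" where "c n = fact r / ln (real n) ^ r" for n
  define \<mu> where "\<mu> n = c n * (n * few_copies_prob n r (t n))" for n
  have \<mu>: "\<mu> \<longlonglongrightarrow> z"
    unfolding \<mu>_def c_def by (rule critical_times.few_copies_limit[OF \<open>critical_times z t\<close> \<open>r \<ge> 1\<close>])
  have "filterlim (\<lambda>n::nat. ln (real n)) at_top sequentially" by real_asymp
  then have "filterlim (\<lambda>n::nat. ln (real n) ^ r) at_top sequentially"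
    using \<open>r \<ge> 1\<close> by (intro filterlim_pow_at_top) auto
  then have c: "c \<longlonglongrightarrow> 0"
    unfolding c_def by (intro real_tendsto_divide_at_top[OF tendsto_const])
  have q: "(\<lambda>n::nat. 1 - 1 / real n) \<longlonglongrightarrow> 1" by real_asymp
  have "(\<lambda>n. (c n * \<mu> n + \<mu> n ^ 2 / (1 - 1 / n) ^ (2 * r) - 2 * z * \<mu> n + z ^ 2) / \<delta> ^ 2)
      \<longlonglongrightarrow> (0 * z + z ^ 2 / 1 ^ (2 * r) - 2 * z * z + z ^ 2) / \<delta> ^ 2"
    using \<open>\<delta> > 0\<close> by (intro tendsto_intros c \<mu> q) auto
  then have lim: "(\<lambda>n. (c n * \<mu> n + \<mu> n ^ 2 / (1 - 1 / n) ^ (2 * r) - 2 * z * \<mu> n + z ^ 2) / \<delta> ^ 2) \<longlonglongrightarrow> 0"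
    by (simp add: power2_eq_square)
  show ?thesis
  proof (rule tendsto_sandwich[OF _ _ tendsto_const lim])
    show "\<forall>\<^sub>F n in sequentially. measure (M n) {\<omega> \<in> space (M n).
            \<delta> \<le> \<bar>fact r / ln (real n) ^ r * real (missing n (\<lambda>s. C n s \<omega>) r (t n)) - z\<bar>}
        \<le> (c n * \<mu> n + \<mu> n ^ 2 / (1 - 1 / n) ^ (2 * r) - 2 * z * \<mu> n + z ^ 2) / \<delta> ^ 2"
      using eventually_ge_at_top[of 1]
    proof eventually_elim
      case (elim n)
      have "0 \<le> c n" using elim by (simp add: c_def)
      from uniform_coupons.deviation_prob_le[OF coupons[OF elim] this \<open>\<delta> > 0\<close>, of r "t n" z] show ?case
        unfolding \<mu>_def c_def .
    qed
  qed simp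
qed

lemma rescaled_completion_tail:
  assumes coupons: "\<And>n. n \<ge> 1 \<Longrightarrow> uniform_coupons (M n) n (C n)"
  shows "(\<lambda>n. measure (M n) {\<omega> \<in> space (M n). z \<le> rescaled_completion n (\<lambda>s. C n s \<omega>)})
           \<longlonglongrightarrow> (if 0 \<le> z then exp (- z) else 1)"
proof (cases "z > 0")
  case True
  have "\<forall>\<^sub>F n in sequentially. z \<le> real n"
    using eventually_ge_at_top[of "nat \<lceil>z\<rceil>"]
    by eventually_elim (simp add: nat_le_iff ceiling_le_iff)
  then have "\<forall>\<^sub>F n in sequentially. (\<Sum>j\<le>n. (-1) ^ j * real (n choose j) * (1 - real j / real n) ^ stage z n) =
      measure (M n) {\<omega> \<in> space (M n). z \<le> rescaled_completion n (\<lambda>s. C n s \<omega>)}"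
    using eventually_ge_at_top[of 1]
  proof eventually_elim
    case (elim n)
    show ?case
      unfolding rescaled_completion_ge_iff[OF elim(2) True elim(1)]
        uniform_coupons.prob_complete[OF coupons[OF elim(2)]] ..
  qed
  with critical_times.complete_prob_limit[OF critical_times_stage[OF True]] show ?thesis
    using True by (auto intro: Lim_transform_eventually)
next
  case False
  have "\<forall>\<^sub>F n in sequentially. measure (M n) {\<omega> \<in> space (M n). z \<le> rescaled_completion n (\<lambda>s. C n s \<omega>)} = 1"
    using eventually_ge_at_top[of 1]
  proof eventually_elim
    case (elim n)
    have "z \<le> rescaled_completion n c" for c
      using False rescaled_completion_nonneg[of n c] by linarith
    then show ?case
      using prob_space.prob_space[OF uniform_coupons.axioms(1)[OF coupons[OF elim]]] by simp
  qed
  then show ?thesis using False by (auto intro: tendsto_eventually)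
qed

text \<open>
  The passage from fixed times to the random completion time, on a single sample path. If the
  rescaled completion time \<open>Z\<close> lies between \<open>j \<delta>\<close> and \<open>(j + 1) \<delta>\<close>, then the completion time lies
  between the stages belonging to \<open>(j + 1) \<delta>\<close> and \<open>j \<delta>\<close>, and by monotonicity the normalised count
  lies between its values there, which are within \<open>\<delta>\<close> of \<open>(j + 1) \<delta>\<close> and \<open>j \<delta>\<close>. For \<open>j = 0\<close> there
  is no stage on one side, but then the lower bound is trivial.
\<close>

lemma empty_spots_near_rescaled_completion:
  assumes n: "n \<ge> 1" and "a \<ge> 0" and "\<delta> > 0" and m: "real m * \<delta> \<le> real n"
    and grid: "\<And>j. 1 \<le> j \<Longrightarrow> j \<le> m \<Longrightarrow>
      \<bar>a * real (missing n c r (stage (real j * \<delta>) n)) - real j * \<delta>\<bar> < \<delta>"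
    and top: "rescaled_completion n c < real m * \<delta>"
  shows "\<bar>a * real (empty_spots n c r) - rescaled_completion n c\<bar> \<le> 2 * \<delta>"
proof (cases "completion_time n c")
  case infinity
  then show ?thesis
    using \<open>\<delta> > 0\<close> by (simp add: rescaled_completion_def empty_spots_never_completed)
next
  case (enat t)
  define Z where "Z = rescaled_completion n c"
  have Z: "Z = real n * exp (- real t / real n)"
    by (simp add: Z_def rescaled_completion_def enat)
  have U: "empty_spots n c r = missing n c r t"
    by (rule empty_spots_at_completion[OF enat])
  define j where "j = nat \<lfloor>Z / \<delta>\<rfloor>"
  have "0 \<le> Z / \<delta>" using \<open>\<delta> > 0\<close> Z by simp
  then have "real j \<le> Z / \<delta>" "Z / \<delta> < real j + 1" by (auto simp: j_def)
  then have j: "real j * \<delta> \<le> Z" "Z < real (Suc j) * \<delta>"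
    using \<open>\<delta> > 0\<close> by (simp_all add: field_simps)
  have "real j * \<delta> < real m * \<delta>" using j top by (simp add: Z_def)
  then have "j < m" using \<open>\<delta> > 0\<close> by simp
  have le_n: "real i * \<delta> \<le> real n" if "i \<le> m" for i
    using that \<open>\<delta> > 0\<close> by (intro order.trans[OF mult_right_mono m]) auto
  have "stage (real (Suc j) * \<delta>) n \<le> t"
  proof -
    have "\<not> t \<le> stage (real (Suc j) * \<delta>) n"
      using le_stage_iff[OF n, of "real (Suc j) * \<delta>" t] le_n[of "Suc j"] j(2) Z \<open>j < m\<close> \<open>\<delta> > 0\<close>
      by (simp del: of_nat_Suc)
    then show ?thesis by simp
  qed
  then have "a * real (missing n c r t) \<le> a * real (missing n c r (stage (real (Suc j) * \<delta>) n))"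
    using \<open>a \<ge> 0\<close> by (intro mult_left_mono) (auto intro: missing_antimono)
  also have "\<dots> < real (Suc j) * \<delta> + \<delta>"
    using grid[of "Suc j"] \<open>j < m\<close> by (simp del: of_nat_Suc add: abs_less_iff)
  finally have upper: "a * real (missing n c r t) < Z + 2 * \<delta>"
    using j by (simp add: algebra_simps)
  have lower: "Z - 2 * \<delta> \<le> a * real (missing n c r t)"
  proof (cases "j = 0")
    case True
    then have "Z - 2 * \<delta> \<le> 0" using j \<open>\<delta> > 0\<close> by simp
    also have "0 \<le> a * real (missing n c r t)" using \<open>a \<ge> 0\<close> by simp
    finally show ?thesis .
  next
    case False
    have "t \<le> stage (real j * \<delta>) n"
      using le_stage_iff[OF n, of "real j * \<delta>" t] le_n[of j] j(1) Z \<open>j < m\<close> \<open>\<delta> > 0\<close> False by simp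
    then have "a * real (missing n c r (stage (real j * \<delta>) n)) \<le> a * real (missing n c r t)"
      using \<open>a \<ge> 0\<close> by (intro mult_left_mono) (auto intro: missing_antimono)
    moreover have "real j * \<delta> - \<delta> < a * real (missing n c r (stage (real j * \<delta>) n))"
      using grid[of j] \<open>j < m\<close> False by (simp add: abs_less_iff)
    ultimately show ?thesis using j by (simp add: algebra_simps)
  qed
  show ?thesis
    using upper lower by (simp add: U Z_def abs_le_iff)
qed

text \<open>
  On the event on the left the sandwich fails, so \<open>Z \<ge> m \<delta>\<close> or the normalised count deviates at one
  of the \<open>m\<close> grid points.
\<close>

lemma (in uniform_coupons) empty_spots_far_prob_le:
  fixes a \<delta> :: real and m r :: nat
  assumes "a \<ge> 0" and "\<delta> > 0" and "real m * \<delta> \<le> real n"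
  shows "prob {\<omega> \<in> space M.
      2 * \<delta> < \<bar>a * real (empty_spots n (\<lambda>s. C s \<omega>) r) - rescaled_completion n (\<lambda>s. C s \<omega>)\<bar>} \<le>
    prob {\<omega> \<in> space M. real m * \<delta> \<le> rescaled_completion n (\<lambda>s. C s \<omega>)} +
    (\<Sum>j\<in>{1..m}. prob {\<omega> \<in> space M.
       \<delta> \<le> \<bar>a * real (missing n (\<lambda>s. C s \<omega>) r (stage (real j * \<delta>) n)) - real j * \<delta>\<bar>})"
    (is "prob ?far \<le> prob ?large + (\<Sum>j\<in>_. prob (?dev j))")
proof -
  have dev_sets: "?dev j \<in> events" for j by measurable
  have large_sets: "?large \<in> events" by measurable
  have union_sets: "(\<Union>j\<in>{1..m}. ?dev j) \<in> events"
    by (intro sets.finite_UN dev_sets) simp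
  have "?far \<subseteq> ?large \<union> (\<Union>j\<in>{1..m}. ?dev j)"
  proof (rule subsetI, rule ccontr)
    fix \<omega> assume \<omega>: "\<omega> \<in> ?far" and out: "\<omega> \<notin> ?large \<union> (\<Union>j\<in>{1..m}. ?dev j)"
    have "\<bar>a * real (empty_spots n (\<lambda>s. C s \<omega>) r) - rescaled_completion n (\<lambda>s. C s \<omega>)\<bar> \<le> 2 * \<delta>"
      by (rule empty_spots_near_rescaled_completion[OF n_pos assms]) (use \<omega> out in \<open>auto simp: not_le\<close>)
    with \<omega> show False by simp
  qed
  then have "prob ?far \<le> prob (?large \<union> (\<Union>j\<in>{1..m}. ?dev j))"
    by (intro finite_measure_mono sets.Un large_sets union_sets)
  also have "\<dots> \<le> prob ?large + prob (\<Union>j\<in>{1..m}. ?dev j)"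
    by (intro measure_Un_le large_sets union_sets)
  also have "\<dots> \<le> prob ?large + (\<Sum>j\<in>{1..m}. prob (?dev j))"
    using dev_sets by (intro add_left_mono finite_measure_subadditive_finite) auto
  finally show ?thesis .
qed

text \<open>
  The probability of \<open>Z \<ge> m \<eta>\<close> tends to \<open>exp (- m \<eta>)\<close>, which is small for large \<open>m\<close>, and for each
  fixed \<open>m\<close> the deviations at the grid points have vanishing probability.
\<close>

lemma empty_spots_minus_rescaled_completion:
  assumes coupons: "\<And>n. n \<ge> 1 \<Longrightarrow> uniform_coupons (M n) n (C n)"
    and "r \<ge> 1" and "\<delta> > 0"
  shows "(\<lambda>n. measure (M n) {\<omega> \<in> space (M n).
      \<delta> < \<bar>fact r / ln (real n) ^ r * real (empty_spots n (\<lambda>s. C n s \<omega>) r) -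
        rescaled_completion n (\<lambda>s. C n s \<omega>)\<bar>}) \<longlonglongrightarrow> 0" (is "?P \<longlonglongrightarrow> 0")
proof (rule tendstoI)
  fix \<epsilon> :: real assume "\<epsilon> > 0"
  define \<eta> where "\<eta> = \<delta> / 2"
  have "\<eta> > 0" and \<delta>: "\<delta> = 2 * \<eta>" using \<open>\<delta> > 0\<close> by (simp_all add: \<eta>_def)
  define a :: "nat \<Rightarrow> real" where "a n = fact r / ln (real n) ^ r" for n
  define dev where "dev j n = measure (M n) {\<omega> \<in> space (M n).
    \<eta> \<le> \<bar>a n * real (missing n (\<lambda>s. C n s \<omega>) r (stage (real j * \<eta>) n)) - real j * \<eta>\<bar>}" for j n
  define large where "large m n =
    measure (M n) {\<omega> \<in> space (M n). real m * \<eta> \<le> rescaled_completion n (\<lambda>s. C n s \<omega>)}" for m n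
  have "(\<lambda>m::nat. exp (- (real m * \<eta>))) \<longlonglongrightarrow> 0"
    using \<open>\<eta> > 0\<close> by real_asymp
  then have "\<forall>\<^sub>F m in sequentially. exp (- (real m * \<eta>)) < \<epsilon> / 2"
    using \<open>\<epsilon> > 0\<close> by (intro order_tendstoD(2)) auto
  then obtain m :: nat where m: "exp (- (real m * \<eta>)) < \<epsilon> / 2"
    by (auto simp: eventually_sequentially)
  have "(\<lambda>n. large m n) \<longlonglongrightarrow> exp (- (real m * \<eta>))"
    using rescaled_completion_tail[of M C "real m * \<eta>", OF coupons] \<open>\<eta> > 0\<close> by (simp add: large_def)
  moreover have "(\<lambda>n. dev j n) \<longlonglongrightarrow> 0" if "j \<in> {1..m}" for j
    unfolding dev_def a_def
    using that \<open>\<eta> > 0\<close> \<open>r \<ge> 1\<close> by (intro missing_concentration coupons critical_times_stage) auto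
  ultimately have "(\<lambda>n. large m n + (\<Sum>j\<in>{1..m}. dev j n)) \<longlonglongrightarrow> exp (- (real m * \<eta>)) + (\<Sum>j\<in>{1..m}. 0)"
    by (intro tendsto_intros) auto
  then have "\<forall>\<^sub>F n in sequentially. large m n + (\<Sum>j\<in>{1..m}. dev j n) < \<epsilon>"
    by (rule order_tendstoD(2)) (use m \<open>\<epsilon> > 0\<close> in simp)
  moreover have "\<forall>\<^sub>F n in sequentially. real m * \<eta> \<le> real n"
    using eventually_ge_at_top[of "nat \<lceil>real m * \<eta>\<rceil>"]
    by eventually_elim (simp add: nat_le_iff ceiling_le_iff)
  ultimately show "\<forall>\<^sub>F n in sequentially. dist (?P n) 0 < \<epsilon>"
    using eventually_ge_at_top[of 1]
  proof eventually_elim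
    case (elim n)
    have "0 \<le> a n" using elim by (simp add: a_def)
    from uniform_coupons.empty_spots_far_prob_le[OF coupons[OF elim(3)] this \<open>\<eta> > 0\<close> elim(2), of r]
    have "?P n \<le> large m n + (\<Sum>j\<in>{1..m}. dev j n)"
      unfolding large_def dev_def a_def \<delta> .
    with elim(1) show ?case by simp
  qed
qed

theorem theorem2p1:
  fixes M :: "nat \<Rightarrow> 'a measure"
    and C :: "nat \<Rightarrow> nat \<Rightarrow> 'a \<Rightarrow> nat"
    and N :: "'b measure"
    and E :: "'b \<Rightarrow> real"
  assumes "\<And>n. n \<ge> 1 \<Longrightarrow> prob_space (M n)"
    and "\<And>n. n \<ge> 1 \<Longrightarrow> prob_space.indep_vars (M n) (\<lambda>_. count_space UNIV) (C n) {1..}"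
    and "\<And>n t. n \<ge> 1 \<Longrightarrow> t \<ge> 1 \<Longrightarrow>
           distr (M n) (count_space UNIV) (C n t) = measure_pmf (pmf_of_set {1..n})"
    and "prob_space N"
    and "distributed N lborel E (exponential_density 1)"
  shows "conv_in_distribution M
           (\<lambda>n \<omega> k. fact (Suc k) * real (empty_spots n (\<lambda>t. C n t \<omega>) (Suc k)) / ln (real n) ^ Suc k)
           N (\<lambda>\<omega> k. E \<omega>)"
proof -
  have coupons: "uniform_coupons (M n) n (C n)" if "n \<ge> 1" for n
    using that assms(1-3) by (simp add: uniform_coupons_def uniform_coupons_axioms_def)
  have prob: "\<forall>\<^sub>F n in sequentially. prob_space (M n)"
    using eventually_ge_at_top[of 1] by eventually_elim (rule assms(1))
  have conv: "conv_in_distribution M (\<lambda>n \<omega>. rescaled_completion n (\<lambda>t. C n t \<omega>)) N E"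
  proof (rule conv_in_distribution_realI[OF prob assms(4)])
    show "\<forall>\<^sub>F n in sequentially. (\<lambda>\<omega>. rescaled_completion n (\<lambda>t. C n t \<omega>)) \<in> borel_measurable (M n)"
      using eventually_ge_at_top[of 1]
      by eventually_elim (rule uniform_coupons.rescaled_completion_measurable[OF coupons])
    show "E \<in> borel_measurable N"
      using assms(5) by (simp add: distributed_def)
    show "(\<lambda>n. measure (M n) {\<omega> \<in> space (M n). z \<le> rescaled_completion n (\<lambda>t. C n t \<omega>)})
        \<longlonglongrightarrow> measure N {\<omega> \<in> space N. z \<le> E \<omega>}" for z
      unfolding prob_space.exponential_prob_ge[OF assms(4,5)] by (rule rescaled_completion_tail[OF coupons])
  qed
  have meas: "\<forall>\<^sub>F n in sequentially.
      (\<lambda>\<omega> k. fact (Suc k) * real (empty_spots n (\<lambda>t. C n t \<omega>) (Suc k)) / ln (real n) ^ Suc k) \<in> borel_measurable (M n)"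
    using eventually_ge_at_top[of 1]
  proof eventually_elim
    case (elim n)
    note uniform_coupons.empty_spots_measurable[OF coupons[OF elim], measurable]
    show ?case by (intro measurable_coordinatewise_then_product) measurable
  qed
  have close: "(\<lambda>n. measure (M n) {\<omega> \<in> space (M n).
      \<bar>fact (Suc k) * real (empty_spots n (\<lambda>t. C n t \<omega>) (Suc k)) / ln (real n) ^ Suc k -
        rescaled_completion n (\<lambda>t. C n t \<omega>)\<bar> > \<delta>}) \<longlonglongrightarrow> 0" if "\<delta> > 0" for k \<delta>
    using empty_spots_minus_rescaled_completion[of M C "Suc k" \<delta>, OF coupons _ that]
    by (simp only: times_divide_eq_left)
  show ?thesis
    by (rule conv_in_distribution_constant_sequence[OF prob assms(4) meas conv close])
qed

end
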